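(* Let $\varphi_0\in H^2(\mathbb{T})$ have zero mean value and let $M_0=\max_{x\in\mathbb{T}}\varphi_0(x)$. Then there exists a solution $f(x,t)$ of the equation $$\partial_tf_x=-\partial_tg-ff_{xx}+(f_x)^2+gf_x$$ with initial datum $f_x(x,0)=\varphi_0(x)$, such that $f_x\in C([0,t_* ),H^2(\mathbb{T}))$ with $t_*=M_0^{-1}$.
   Context: $\mathbb{T}$ is the one-dimensional torus, identified with $[-\pi,\pi)$ with periodic boundary conditions (imposed on $f_x$). Subscripts $x$ denote derivatives in $x$. In the equation, $g$ and $f$ are determined by $f_x$ through $$g(t)=\frac1\pi\int_0^t\|f_x(\tau)\|_{L^2(-\pi,\pi)}^2\,d\tau,\qquad f(x,t)=\int_{-\pi}^xf_x(x',t)\,dx'.$$ If $M_0=0$ (i.e. $\varphi_0=0$), $M_0^{-1}$ is read as $+\infty$. *)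

theory Defs
  imports "HOL-Analysis.Analysis"
begin

text \<open>Functions on the torus are \<open>2\<pi>\<close>-periodic functions on the real line; integrals over the
  torus are taken over \<open>[-\<pi>,\<pi>)\<close>.\<close>

definition periodic_2pi :: "(real \<Rightarrow> real) \<Rightarrow> bool" where
  "periodic_2pi u \<longleftrightarrow> (\<forall>x. u (x + 2 * pi) = u x)"

definition torus_integral :: "(real \<Rightarrow> real) \<Rightarrow> real" where
  "torus_integral u = (LBINT x:{-pi..<pi}. u x)"

definition L2_torus :: "(real \<Rightarrow> real) set" where
  "L2_torus = {u \<in> borel_measurable borel. set_integrable lborel {-pi..<pi} (\<lambda>x. (u x)\<^sup>2)}"

definition L2_norm_torus :: "(real \<Rightarrow> real) \<Rightarrow> real" where
  "L2_norm_torus u = sqrt (torus_integral (\<lambda>x. (u x)\<^sup>2))"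

definition test_functions_torus :: "(real \<Rightarrow> real) set" where
  "test_functions_torus =
     {\<psi>. periodic_2pi \<psi> \<and> (\<forall>n x. ((deriv ^^ n) \<psi>) field_differentiable (at x))}"

definition has_weak_deriv :: "(real \<Rightarrow> real) \<Rightarrow> (real \<Rightarrow> real) \<Rightarrow> bool" where
  "has_weak_deriv u v \<longleftrightarrow> u \<in> L2_torus \<and> v \<in> L2_torus \<and>
     (\<forall>\<psi>\<in>test_functions_torus.
        torus_integral (\<lambda>x. u x * deriv \<psi> x) = - torus_integral (\<lambda>x. v x * \<psi> x))"

text \<open>A weak derivative is determined only up to null sets; the choice made here does not affect
  \<open>L2\<close> norms or further weak derivatives.\<close>

definition weak_deriv :: "(real \<Rightarrow> real) \<Rightarrow> (real \<Rightarrow> real)" where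
  "weak_deriv u = (SOME v. has_weak_deriv u v)"

text \<open>Elements of \<open>H2(T)\<close> are represented by their continuous representative, so that maxima,
  pointwise values and classical first derivatives are meaningful.\<close>

definition H2_torus :: "(real \<Rightarrow> real) set" where
  "H2_torus = {u. continuous_on UNIV u \<and> periodic_2pi u \<and>
     (\<exists>v w. has_weak_deriv u v \<and> has_weak_deriv v w)}"

definition H2_norm_torus :: "(real \<Rightarrow> real) \<Rightarrow> real" where
  "H2_norm_torus u = sqrt ((L2_norm_torus u)\<^sup>2 + (L2_norm_torus (weak_deriv u))\<^sup>2
     + (L2_norm_torus (weak_deriv (weak_deriv u)))\<^sup>2)"

definition time_interval :: "ereal \<Rightarrow> real set" where
  "time_interval T = {t. 0 \<le> t \<and> ereal t < T}"

text \<open>The space \<open>C([0,T), H2(T))\<close>, for functions of \<open>(x,t)\<close>.\<close>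

definition C_H2 :: "ereal \<Rightarrow> (real \<Rightarrow> real \<Rightarrow> real) set" where
  "C_H2 T = {u. \<forall>s\<in>time_interval T. (\<lambda>x. u x s) \<in> H2_torus \<and>
     ((\<lambda>t. H2_norm_torus (\<lambda>x. u x t - u x s)) \<longlongrightarrow> 0) (at s within time_interval T)}"

definition g_of :: "(real \<Rightarrow> real \<Rightarrow> real) \<Rightarrow> real \<Rightarrow> real" where
  "g_of fx t = (1 / pi) * (LBINT \<tau>=ereal 0..ereal t. (L2_norm_torus (\<lambda>x. fx x \<tau>))\<^sup>2)"

text \<open>\<open>fx\<close> is the \<open>x\<close>-derivative of \<open>f\<close>, and the equation holds pointwise with classical
  derivatives. This is meaningful since \<open>H2\<close> functions are continuously differentiable. The
  derivatives in \<open>t\<close> are one-sided at \<open>t = 0\<close>.\<close>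

definition is_solution ::
    "ereal \<Rightarrow> (real \<Rightarrow> real \<Rightarrow> real) \<Rightarrow> (real \<Rightarrow> real \<Rightarrow> real) \<Rightarrow> bool" where
  "is_solution T f fx \<longleftrightarrow>
     (\<forall>t\<in>time_interval T. \<forall>x.
        ((\<lambda>y. f y t) has_real_derivative fx x t) (at x) \<and>
        f x t = (LBINT y=ereal (-pi)..ereal x. fx y t) \<and>
        (\<exists>fxx gt.
           ((\<lambda>y. fx y t) has_real_derivative fxx) (at x) \<and>
           (g_of fx has_real_derivative gt) (at t within time_interval T) \<and>
           ((\<lambda>\<tau>. fx x \<tau>) has_real_derivative
              (- gt - f x t * fxx + (fx x t)\<^sup>2 + g_of fx t * fx x t))
             (at t within time_interval T)))"

text \<open>The extended-real inverse gives \<open>t_star 0 = \<infinity>\<close>.\<close>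

definition t_star :: "real \<Rightarrow> ereal" where
  "t_star M = inverse (ereal M)"

end

theory Submission
  imports Defs
begin

text \<open>
  In Lagrangian variables the equation is solvable in closed form. Let \<open>\<gamma>\<close> be the flow of \<open>f\<close> and let
  \<open>u\<close> be \<open>f\<^sub>x\<close> along the flow. Then \<open>u' = u\<^sup>2 + g u - g'\<close>, a Riccati equation with the particular
  solution \<open>-g\<close>; so \<open>v = u + g\<close> satisfies the Bernoulli equation \<open>v' = v\<^sup>2 - g v\<close>. With the new
  time \<open>s = \<eta>(t)\<close>, where \<open>\<eta>' = exp (- integral of g)\<close> and \<open>\<eta> 0 = 0\<close>, its solution is
  \<open>v = \<eta>' \<phi> / (1 - s \<phi>)\<close>, and the Jacobian of the flow is \<open>\<rho> = \<eta>' / (1 - s \<phi>)\<close>.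

  The flow maps the torus to itself, so \<open>\<rho>\<close> has mean \<open>1\<close>. This closes the system: \<open>\<eta>' = 1 / K(s)\<close>,
  where \<open>K(s)\<close> is the mean of \<open>1 / (1 - s \<phi>)\<close>. Hence \<open>t = H(s)\<close>, where \<open>H\<close> is the primitive of \<open>K\<close>
  that vanishes at \<open>0\<close>. As \<open>\<phi>\<close> has zero mean, \<open>1 / (1 - y) \<ge> 1 + y\<close> gives \<open>K \<ge> 1\<close>
  (\<open>K_ge_1\<close>), so \<open>H(s) \<ge> s\<close>, and \<open>H\<close> takes every value in \<open>[0, 1/M)\<close> on the set of \<open>s \<ge> 0\<close> with
  \<open>s M < 1\<close>, where nothing blows up (\<open>\<eta>_time\<close>). The proof runs these formulas backwards: everything
  is defined explicitly as a function of \<open>s\<close>, composed with the inverse \<open>X\<close> of the flow map, and the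
  equation is verified by differentiation (\<open>U_evolution\<close>, \<open>energy\<close>, \<open>solution\<close>).

  For the regularity, write \<open>w\<close> for the second derivative of \<open>\<phi>\<close>. The derivatives of \<open>f\<^sub>x\<close> along the
  flow are \<open>f\<^sub>x\<^sub>x = \<phi>' / (1 - s \<phi>)\<close> and \<open>f\<^sub>x\<^sub>x\<^sub>x = K (w + s \<phi>'\<^sup>2 / (1 - s \<phi>))\<close>. Everything except
  the term with \<open>w\<close> is jointly continuous. The compositions of \<open>w \<in> L\<^sup>2\<close> with the
  diffeomorphisms \<open>X s\<close> depend continuously on \<open>s\<close> in \<open>L\<^sup>2\<close> because this holds for continuous
  functions, which are dense, and the Jacobians are locally bounded (\<open>X_comp_L2_tendsto\<close>).

  To connect weak derivatives with classical ones, trigonometric polynomials are shown to be dense in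
  \<open>L\<^sup>2\<close> (\<open>trig_poly_dense_L2\<close>). As they are test functions, weak derivatives are unique up to null
  sets, and a function in \<open>H\<^sup>2\<close> is continuously differentiable with an absolutely continuous
  derivative (\<open>H2_torus_classical\<close>).
\<close>

section \<open>Square-integrable functions on the torus\<close>

text \<open>Lebesgue measure on one period. As a finite measure space it makes the general theorems on
  Bochner integrals (dominated convergence, Fubini) directly applicable.\<close>
definition torus_measure :: "real measure" where
  "torus_measure = restrict_space lborel {-pi..<pi}"

lemma torus_integral_eq: "torus_integral u = integral\<^sup>L torus_measure u"
  unfolding torus_integral_def torus_measure_def set_lebesgue_integral_def
  by (simp add: integral_restrict_space)

lemma integrable_torus_iff:
  fixes u :: "real \<Rightarrow> real"
  shows "integrable torus_measure u \<longleftrightarrow> set_integrable lborel {-pi..<pi} u"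
  unfolding torus_measure_def set_integrable_def by (subst integrable_restrict_space) auto

lemma space_torus_measure [simp]: "space torus_measure = {-pi..<pi}"
  by (simp add: torus_measure_def space_restrict_space)

lemma AE_torus_iff: "(AE x in torus_measure. P x) \<longleftrightarrow> (AE x in lborel. x \<in> {-pi..<pi} \<longrightarrow> P x)"
  unfolding torus_measure_def by (simp add: AE_restrict_space_iff)

lemma measurable_torus [measurable_dest]:
  "u \<in> borel_measurable borel \<Longrightarrow> u \<in> borel_measurable torus_measure"
  unfolding torus_measure_def by (simp add: measurable_restrict_space1)

interpretation torus: finite_measure torus_measure
proof
  have "emeasure lborel {-pi..<pi} < \<infinity>" by simp
  then show "emeasure torus_measure (space torus_measure) \<noteq> \<infinity>"
    unfolding space_torus_measure unfolding torus_measure_def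
    by (subst emeasure_restrict_space) auto
qed

lemma measure_torus_space: "measure torus_measure {-pi..<pi} = 2 * pi"
  unfolding torus_measure_def by (subst measure_restrict_space) auto

lemma torus_integral_const: "torus_integral (\<lambda>x. c) = 2 * pi * c"
  by (simp add: torus_integral_eq measure_torus_space)

lemma L2_torus_iff:
  "u \<in> L2_torus \<longleftrightarrow> u \<in> borel_measurable borel \<and> integrable torus_measure (\<lambda>x. (u x)\<^sup>2)"
  by (simp add: L2_torus_def integrable_torus_iff)

lemma L2_mult_integrable:
  assumes "u \<in> L2_torus" "v \<in> L2_torus"
  shows "integrable torus_measure (\<lambda>x. u x * v x)"
proof (rule Bochner_Integration.integrable_bound)
  show "integrable torus_measure (\<lambda>x. (u x)\<^sup>2 + (v x)\<^sup>2)"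
    using assms by (auto simp: L2_torus_iff)
  have [measurable]: "u \<in> borel_measurable borel" "v \<in> borel_measurable borel"
    using assms by (auto simp: L2_torus_iff)
  show "(\<lambda>x. u x * v x) \<in> borel_measurable torus_measure"
    by (intro measurable_torus) measurable
  have "norm (a * b) \<le> norm (a\<^sup>2 + b\<^sup>2)" for a b :: real
  proof -
    have "2 * (\<bar>a\<bar> * \<bar>b\<bar>) \<le> a\<^sup>2 + b\<^sup>2"
      using sum_squares_bound[of "\<bar>a\<bar>" "\<bar>b\<bar>"] by simp
    moreover have "0 \<le> \<bar>a\<bar> * \<bar>b\<bar>" by simp
    ultimately show ?thesis unfolding real_norm_def abs_mult by linarith
  qed
  then show "AE x in torus_measure. norm (u x * v x) \<le> norm ((u x)\<^sup>2 + (v x)\<^sup>2)"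
    by simp
qed

lemma L2_add: "u \<in> L2_torus \<Longrightarrow> v \<in> L2_torus \<Longrightarrow> (\<lambda>x. u x + v x) \<in> L2_torus"
  using L2_mult_integrable[of u v]
  by (auto simp: L2_torus_iff power2_sum mult.assoc)

lemma L2_cmult: "u \<in> L2_torus \<Longrightarrow> (\<lambda>x. c * u x) \<in> L2_torus"
  by (auto simp: L2_torus_iff power_mult_distrib)

lemma L2_diff: "u \<in> L2_torus \<Longrightarrow> v \<in> L2_torus \<Longrightarrow> (\<lambda>x. u x - v x) \<in> L2_torus"
  using L2_add[of u "\<lambda>x. (-1) * v x"] L2_cmult[of v "-1"] by simp

lemma L2_bounded:
  assumes "u \<in> borel_measurable borel" "\<And>x. x \<in> {-pi..<pi} \<Longrightarrow> \<bar>u x\<bar> \<le> R"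
  shows "u \<in> L2_torus"
  unfolding L2_torus_iff
proof
  have [measurable]: "u \<in> borel_measurable borel" by fact
  show "integrable torus_measure (\<lambda>x. (u x)\<^sup>2)"
  proof (rule torus.integrable_const_bound[where B="R\<^sup>2"])
    show "AE x in torus_measure. norm ((u x)\<^sup>2) \<le> R\<^sup>2"
      by (rule AE_I2) (use assms(2) in \<open>auto simp: abs_le_square_iff[symmetric] intro: order.trans[OF _ abs_ge_self]\<close>)
    show "(\<lambda>x. (u x)\<^sup>2) \<in> borel_measurable torus_measure"
      by (intro measurable_torus) measurable
  qed
qed fact

lemma L2_continuous:
  assumes "continuous_on UNIV u"
  shows "u \<in> L2_torus"
proof -
  have "compact (u ` {-pi..pi})"
    by (rule compact_continuous_image) (auto intro: continuous_on_subset[OF assms])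
  then obtain R where "\<And>x. x \<in> {-pi..pi} \<Longrightarrow> \<bar>u x\<bar> \<le> R"
    by (metis compact_imp_bounded bounded_real image_eqI)
  then show ?thesis
    using assms by (intro L2_bounded[of u R]) (auto intro: borel_measurable_continuous_onI)
qed

lemma L2_const: "(\<lambda>x. c) \<in> L2_torus"
  by (intro L2_continuous continuous_intros)

lemma L2_integrable: "u \<in> L2_torus \<Longrightarrow> integrable torus_measure u"
  using L2_mult_integrable[OF _ L2_const[of 1]] by simp

lemma L2_integrable_square: "u \<in> L2_torus \<Longrightarrow> integrable torus_measure (\<lambda>x. (u x)\<^sup>2)"
  by (simp add: L2_torus_iff)

lemma torus_integral_square_cong_AE:
  assumes "u \<in> L2_torus" "v \<in> L2_torus" "AE x in torus_measure. u x = v x"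
  shows "torus_integral (\<lambda>x. (u x)\<^sup>2) = torus_integral (\<lambda>x. (v x)\<^sup>2)"
  unfolding torus_integral_eq
  using assms by (intro integral_cong_AE) (auto simp: L2_torus_iff)

lemma torus_integral_square_le:
  assumes "u \<in> L2_torus" "v \<in> L2_torus"
  shows "torus_integral (\<lambda>x. (u x + v x)\<^sup>2) \<le> 2 * torus_integral (\<lambda>x. (u x)\<^sup>2) + 2 * torus_integral (\<lambda>x. (v x)\<^sup>2)"
proof -
  have "torus_integral (\<lambda>x. (u x + v x)\<^sup>2) \<le> integral\<^sup>L torus_measure (\<lambda>x. 2 * (u x)\<^sup>2 + 2 * (v x)\<^sup>2)"
    unfolding torus_integral_eq
  proof (rule integral_mono)
    fix x
    show "(u x + v x)\<^sup>2 \<le> 2 * (u x)\<^sup>2 + 2 * (v x)\<^sup>2"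
      using sum_squares_bound[of "u x" "v x"] by (simp add: power2_sum)
  qed (use assms L2_add[OF assms] in \<open>auto simp: L2_torus_iff\<close>)
  also have "\<dots> = 2 * torus_integral (\<lambda>x. (u x)\<^sup>2) + 2 * torus_integral (\<lambda>x. (v x)\<^sup>2)"
    unfolding torus_integral_eq using assms by (auto simp: L2_torus_iff)
  finally show ?thesis .
qed

lemma torus_integral_nonneg: "(\<And>x. 0 \<le> u x) \<Longrightarrow> 0 \<le> torus_integral u"
  by (simp add: torus_integral_eq)

section \<open>Density of trigonometric polynomials\<close>

text \<open>Generated as an algebra by cosine and sine. In this form closure under differentiation,
  and hence smoothness, is a structural induction.\<close>
inductive trig_poly :: "(real \<Rightarrow> real) \<Rightarrow> bool" where
  const: "trig_poly (\<lambda>x. c)"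
| cos: "trig_poly cos"
| sin: "trig_poly sin"
| add: "trig_poly p \<Longrightarrow> trig_poly q \<Longrightarrow> trig_poly (\<lambda>x. p x + q x)"
| mult: "trig_poly p \<Longrightarrow> trig_poly q \<Longrightarrow> trig_poly (\<lambda>x. p x * q x)"

lemma trig_poly_deriv:
  "trig_poly p \<Longrightarrow> \<exists>p'. trig_poly p' \<and> (\<forall>x. (p has_real_derivative p' x) (at x))"
proof (induction rule: trig_poly.induct)
  case (const c)
  then show ?case by (intro exI[of _ "\<lambda>x. 0"]) (auto intro: trig_poly.const)
next
  case cos
  have "trig_poly (\<lambda>x. (-1) * sin x)" by (intro trig_poly.intros)
  then show ?case by (intro exI[of _ "\<lambda>x. (-1) * sin x"]) (auto intro!: derivative_eq_intros)
next
  case sin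
  show ?case by (intro exI[of _ cos]) (auto intro!: derivative_eq_intros trig_poly.intros)
next
  case (add p q)
  then obtain p' q' where "trig_poly p'" "trig_poly q'"
    "\<And>x. (p has_real_derivative p' x) (at x)" "\<And>x. (q has_real_derivative q' x) (at x)" by blast
  then show ?case
    by (intro exI[of _ "\<lambda>x. p' x + q' x"]) (auto intro!: derivative_eq_intros trig_poly.intros)
next
  case (mult p q)
  then obtain p' q' where *: "trig_poly p'" "trig_poly q'"
    "\<And>x. (p has_real_derivative p' x) (at x)" "\<And>x. (q has_real_derivative q' x) (at x)" by blast
  show ?case
  proof (intro exI[of _ "\<lambda>x. p' x * q x + q' x * p x"] conjI allI)
    show "trig_poly (\<lambda>x. p' x * q x + q' x * p x)"
      using * mult by (intro trig_poly.intros)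
    show "((\<lambda>x. p x * q x) has_real_derivative p' x * q x + q' x * p x) (at x)" for x
      by (rule DERIV_mult[OF *(3,4)])
  qed
qed

lemma trig_poly_higher_deriv: "trig_poly p \<Longrightarrow> trig_poly ((deriv ^^ n) p)"
proof (induction n)
  case (Suc n)
  then obtain p' where p': "trig_poly p'" "\<And>x. ((deriv ^^ n) p has_real_derivative p' x) (at x)"
    using trig_poly_deriv by blast
  then have "deriv ((deriv ^^ n) p) = p'"
    using DERIV_imp_deriv by blast
  with p' show ?case by simp
qed simp

lemma trig_poly_differentiable: "trig_poly p \<Longrightarrow> p field_differentiable (at x)"
  using trig_poly_deriv field_differentiable_def by blast

lemma trig_poly_continuous: "trig_poly p \<Longrightarrow> continuous_on S p"
  by (meson continuous_at_imp_continuous_on field_differentiable_imp_continuous_at trig_poly_differentiable)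

lemma trig_poly_periodic: "trig_poly p \<Longrightarrow> p (x + 2 * pi) = p x"
  by (induction rule: trig_poly.induct) auto

lemma trig_poly_test: "trig_poly p \<Longrightarrow> p \<in> test_functions_torus"
  unfolding test_functions_torus_def periodic_2pi_def
  using trig_poly_periodic trig_poly_differentiable trig_poly_higher_deriv by blast

text \<open>Continuity of the factor \<open>F\<close> is not obvious at the point \<open>-1\<close>, where \<open>Arg\<close> jumps. The graph of
  \<open>F\<close> is however the image of the compact interval under \<open>x \<mapsto> (cis x, h x)\<close>, hence closed, and
  a function with closed graph into a compact set is continuous.\<close>
lemma factor_through_circle:
  fixes h :: "real \<Rightarrow> real"
  assumes cont: "continuous_on {-pi..pi} h" and ends: "h (-pi) = h pi"
  obtains F where "continuous_on (sphere 0 1) F" "\<And>x. x \<in> {-pi..pi} \<Longrightarrow> F (cis x) = h x"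
proof
  let ?F = "\<lambda>z. h (Arg z)"
  show eq: "?F (cis x) = h x" if "x \<in> {-pi..pi}" for x
  proof (cases "x = -pi")
    case True
    have "cis (-pi) = cis pi" by (simp add: complex_eq_iff)
    moreover have "Arg (cis pi) = pi" by (intro Arg_cis) auto
    ultimately show ?thesis using True ends by simp
  next
    case False
    then have "Arg (cis x) = x" using that by (intro Arg_cis) auto
    then show ?thesis by simp
  qed
  have img: "(\<lambda>z. (z, ?F z)) ` sphere 0 1 = (\<lambda>x. (cis x, h x)) ` {-pi..pi}"
  proof (intro equalityI subsetI)
    fix y assume "y \<in> (\<lambda>z. (z, ?F z)) ` sphere 0 1"
    then obtain z where z: "norm z = 1" "y = (z, ?F z)" by auto
    then have "z \<noteq> 0" by auto
    then have "cis (Arg z) = z" using cis_Arg[of z] z(1) by (simp add: sgn_div_norm)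
    then have "y = (cis (Arg z), h (Arg z))" using z(2) by simp
    moreover have "Arg z \<in> {-pi..pi}" using Arg_bounded[of z] by auto
    ultimately show "y \<in> (\<lambda>x. (cis x, h x)) ` {-pi..pi}" by (rule image_eqI)
  next
    fix y assume "y \<in> (\<lambda>x. (cis x, h x)) ` {-pi..pi}"
    then obtain x where x: "x \<in> {-pi..pi}" "y = (cis x, h x)" by auto
    then show "y \<in> (\<lambda>z. (z, ?F z)) ` sphere 0 1"
      using eq[OF x(1)] by (intro image_eqI[of _ _ "cis x"]) auto
  qed
  have comp: "compact ((\<lambda>x. (cis x, h x)) ` {-pi..pi})"
    by (rule compact_continuous_image) (auto intro!: continuous_intros cont)
  have "compact (h ` {-pi..pi})"
    by (rule compact_continuous_image) (auto intro: cont)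
  moreover have "?F \<in> sphere 0 1 \<rightarrow> h ` {-pi..pi}"
  proof
    fix z :: complex
    have "Arg z \<in> {-pi..pi}" using Arg_bounded[of z] by auto
    then show "?F z \<in> h ` {-pi..pi}" by (rule imageI)
  qed
  ultimately show "continuous_on (sphere 0 1) ?F"
    using compact_imp_closed[OF comp] by (intro continuous_from_closed_graph) (simp_all add: img)
qed

lemma periodic_extension:
  fixes h :: "real \<Rightarrow> real"
  assumes cont: "continuous_on {-pi..pi} h" and ends: "h (-pi) = h pi"
  obtains H where "continuous_on UNIV H" "periodic_2pi H" "\<And>x. x \<in> {-pi..pi} \<Longrightarrow> H x = h x"
proof -
  obtain F where F: "continuous_on (sphere 0 1) F" "\<And>x. x \<in> {-pi..pi} \<Longrightarrow> F (cis x) = h x"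
    using factor_through_circle[OF assms] by blast
  have "continuous_on UNIV (\<lambda>x. F (cis x))"
    by (intro continuous_on_compose2[OF F(1)] continuous_intros) auto
  moreover have "periodic_2pi (\<lambda>x. F (cis x))"
    by (auto simp: periodic_2pi_def cis.code)
  ultimately show thesis using that F(2) by blast
qed

text \<open>This turns the Stone-Weierstrass theorem for polynomials in two real variables, applied on the
  unit circle, into the approximation theorem for periodic functions.\<close>
lemma trig_poly_of_real_polynomial:
  assumes "real_polynomial_function p"
  shows "trig_poly (\<lambda>x. p (cis x))"
  using assms
proof (induction rule: real_polynomial_function.induct)
  case (linear f)
  then interpret bounded_linear f .
  have "f (cis x) = f 1 * cos x + f \<i> * sin x" for x
  proof -
    have "cis x = cos x *\<^sub>R 1 + sin x *\<^sub>R \<i>" by (simp add: complex_eq_iff)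
    then show ?thesis by (simp add: add scaleR)
  qed
  then show ?case by (simp only:) (intro trig_poly.intros)
qed (auto intro: trig_poly.intros)

lemma trig_poly_uniformly_dense:
  fixes h :: "real \<Rightarrow> real"
  assumes "continuous_on {-pi..pi} h" "h (-pi) = h pi" "e > 0"
  obtains q where "trig_poly q" "\<And>x. x \<in> {-pi..pi} \<Longrightarrow> \<bar>h x - q x\<bar> < e"
proof -
  obtain F where F: "continuous_on (sphere 0 1) F" "\<And>x. x \<in> {-pi..pi} \<Longrightarrow> F (cis x) = h x"
    using factor_through_circle[OF assms(1,2)] by blast
  obtain p where p: "real_polynomial_function p" "\<And>z. z \<in> sphere 0 1 \<Longrightarrow> \<bar>F z - p z\<bar> < e"
    using Stone_Weierstrass_real_polynomial_function[OF compact_sphere F(1) assms(3)] by blast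
  show thesis
  proof (rule that[OF trig_poly_of_real_polynomial[OF p(1)]])
    fix x :: real assume "x \<in> {-pi..pi}"
    then show "\<bar>h x - p (cis x)\<bar> < e" using p(2)[of "cis x"] F(2)[of x] by simp
  qed
qed

text \<open>A measurable function is an almost everywhere limit of continuous functions. Clipping these to
  the range of \<open>w\<close> supplies the dominating function that turns pointwise into \<open>L\<^sup>2\<close> convergence,
  and a cutoff near the end points makes the approximants compatible with periodicity.\<close>
lemma bounded_L2_approx_continuous:
  fixes w :: "real \<Rightarrow> real"
  assumes w[measurable]: "w \<in> borel_measurable borel" and R: "\<And>x. \<bar>w x\<bar> \<le> R" and "e > 0"
  obtains h where "continuous_on UNIV h" "h (-pi) = 0" "h pi = 0" "torus_integral (\<lambda>x. (w x - h x)\<^sup>2) < e"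
proof -
  have "R \<ge> 0" using R[of 0] by simp
  have "w \<in> borel_measurable lebesgue" using w
    by (simp add: measurable_completion)
  then have "w measurable_on UNIV"
    by (simp add: measurable_on_iff_borel_measurable)
  then obtain N g where N: "negligible N" and g: "\<And>n. continuous_on UNIV (g n)"
    and lim: "\<And>x. x \<notin> N \<Longrightarrow> (\<lambda>n. g n x) \<longlonglongrightarrow> w x"
    unfolding measurable_on_def by auto
  \<comment> \<open>The first factor is the cutoff, which tends to \<open>1\<close> inside the period.\<close>
  define h where "h n x = min 1 (real n * max 0 (pi - \<bar>x\<bar>)) * max (-R) (min R (g n x))" for n x
  have hc: "continuous_on UNIV (h n)" for n
    unfolding h_def by (intro continuous_intros g)
  have hb: "\<bar>h n x\<bar> \<le> R" for n x
  proof -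
    have "\<bar>h n x\<bar> \<le> 1 * R"
      unfolding h_def abs_mult using \<open>R \<ge> 0\<close> by (intro mult_mono) auto
    then show ?thesis by simp
  qed
  have hlim: "(\<lambda>n. h n x) \<longlonglongrightarrow> w x" if "x \<notin> N" "x \<in> {-pi<..<pi}" for x
  proof -
    have "(\<lambda>n. max (-R) (min R (g n x))) \<longlonglongrightarrow> max (-R) (min R (w x))"
      by (intro tendsto_intros lim that)
    moreover have "max (-R) (min R (w x)) = w x" using R[of x] by auto
    moreover have "(\<lambda>n. min 1 (real n * max 0 (pi - \<bar>x\<bar>))) \<longlonglongrightarrow> 1"
    proof (rule tendsto_eventually)
      have "eventually (\<lambda>n. real n \<ge> 1 / (pi - \<bar>x\<bar>)) sequentially"
        using filterlim_real_sequentially[unfolded filterlim_at_top] by blast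
      then show "eventually (\<lambda>n. min 1 (real n * max 0 (pi - \<bar>x\<bar>)) = 1) sequentially"
        by eventually_elim (use that in \<open>auto simp: field_simps min_def max_def\<close>)
    qed
    ultimately show ?thesis
      unfolding h_def using tendsto_mult[of _ 1 sequentially _ "w x"] by fastforce
  qed
  have "(\<lambda>n. integral\<^sup>L torus_measure (\<lambda>x. (w x - h n x)\<^sup>2)) \<longlonglongrightarrow> integral\<^sup>L torus_measure (\<lambda>x. 0)"
  proof (rule integral_dominated_convergence)
    show "integrable torus_measure (\<lambda>x. (2 * R)\<^sup>2)" by simp
    have [measurable]: "h n \<in> borel_measurable borel" for n
      using hc by (rule borel_measurable_continuous_onI)
    show "(\<lambda>x. (w x - h n x)\<^sup>2) \<in> borel_measurable torus_measure" for n
      by (intro measurable_torus) measurable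
    show "(\<lambda>x. 0) \<in> borel_measurable torus_measure" by simp
    show "AE x in torus_measure. norm ((w x - h n x)\<^sup>2) \<le> (2 * R)\<^sup>2" for n
    proof (rule AE_I2)
      fix x
      have "\<bar>w x - h n x\<bar> \<le> \<bar>2 * R\<bar>" using R[of x] hb[of n x] by linarith
      then show "norm ((w x - h n x)\<^sup>2) \<le> (2 * R)\<^sup>2" by (simp only: abs_le_square_iff real_norm_def abs_power2)
    qed
    have "AE x in lebesgue. x \<notin> N"
      using N by (intro AE_not_in) (simp add: negligible_iff_null_sets)
    then have "AE x in lborel. x \<notin> N" by (simp add: AE_completion_iff)
    moreover have "AE x in lborel. x \<noteq> -pi" by (rule AE_lborel_singleton)
    ultimately show "AE x in torus_measure. (\<lambda>n. (w x - h n x)\<^sup>2) \<longlonglongrightarrow> 0"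
      unfolding AE_torus_iff
    proof eventually_elim
      case (elim x)
      then show ?case
        using tendsto_power[OF tendsto_diff[OF tendsto_const[of "w x"] hlim[of x]], of 2]
        by (auto simp: less_le)
    qed
  qed
  then have "eventually (\<lambda>n. torus_integral (\<lambda>x. (w x - h n x)\<^sup>2) < e) sequentially"
    unfolding torus_integral_eq using \<open>e > 0\<close> by (intro order_tendstoD) simp_all
  then obtain n where "torus_integral (\<lambda>x. (w x - h n x)\<^sup>2) < e"
    using eventually_happens by fastforce
  then show thesis using that[OF hc[of n]] by (simp add: h_def)
qed

lemma L2_approx_truncation:
  assumes w: "w \<in> L2_torus" and "e > 0"
  obtains R where "torus_integral (\<lambda>x. (w x - max (-R) (min R (w x)))\<^sup>2) < e"
proof -
  have [measurable]: "w \<in> borel_measurable borel" using w by (simp add: L2_torus_iff)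
  have "(\<lambda>n. integral\<^sup>L torus_measure (\<lambda>x. (w x - max (-real n) (min (real n) (w x)))\<^sup>2)) \<longlonglongrightarrow> integral\<^sup>L torus_measure (\<lambda>x. 0)"
  proof (rule integral_dominated_convergence)
    show "integrable torus_measure (\<lambda>x. (w x)\<^sup>2)" using w by (simp add: L2_torus_iff)
    show "(\<lambda>x. (w x - max (-real n) (min (real n) (w x)))\<^sup>2) \<in> borel_measurable torus_measure" for n
      by (intro measurable_torus) measurable
    show "(\<lambda>x. 0) \<in> borel_measurable torus_measure" by simp
    show "AE x in torus_measure. norm ((w x - max (-real n) (min (real n) (w x)))\<^sup>2) \<le> (w x)\<^sup>2" for n
      by (rule AE_I2) (auto simp: abs_le_square_iff[symmetric])
    show "AE x in torus_measure. (\<lambda>n. (w x - max (-real n) (min (real n) (w x)))\<^sup>2) \<longlonglongrightarrow> 0"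
    proof (rule AE_I2)
      fix x
      have "eventually (\<lambda>n. real n \<ge> \<bar>w x\<bar>) sequentially"
        using filterlim_real_sequentially[unfolded filterlim_at_top] by blast
      then have "eventually (\<lambda>n. (w x - max (-real n) (min (real n) (w x)))\<^sup>2 = 0) sequentially"
        by eventually_elim auto
      then show "(\<lambda>n. (w x - max (-real n) (min (real n) (w x)))\<^sup>2) \<longlonglongrightarrow> 0"
        by (rule tendsto_eventually)
    qed
  qed
  then have "eventually (\<lambda>n. torus_integral (\<lambda>x. (w x - max (-real n) (min (real n) (w x)))\<^sup>2) < e) sequentially"
    unfolding torus_integral_eq using \<open>e > 0\<close> by (intro order_tendstoD) simp_all
  then show thesis using that eventually_happens by fastforce
qed

lemma trig_poly_dense_L2:
  assumes w: "w \<in> L2_torus" and "e > 0"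
  obtains q where "trig_poly q" "torus_integral (\<lambda>x. (w x - q x)\<^sup>2) < e"
proof -
  have [measurable]: "w \<in> borel_measurable borel" using w by (simp add: L2_torus_iff)
  obtain R where R: "torus_integral (\<lambda>x. (w x - max (-R) (min R (w x)))\<^sup>2) < e / 16"
    using L2_approx_truncation[OF w, of "e / 16"] \<open>e > 0\<close> by auto
  define v where "v x = max (-R) (min R (w x))" for x
  have vb: "\<bar>v x\<bar> \<le> \<bar>R\<bar>" for x unfolding v_def by auto
  have vm: "v \<in> borel_measurable borel" unfolding v_def by measurable
  obtain h where h: "continuous_on UNIV h" "h (-pi) = 0" "h pi = 0" "torus_integral (\<lambda>x. (v x - h x)\<^sup>2) < e / 16"
    using bounded_L2_approx_continuous[OF vm vb, of "e / 16"] \<open>e > 0\<close> by auto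
  \<comment> \<open>A uniform error \<open>d\<close> costs \<open>2 \<pi> d\<^sup>2 = e / 16\<close> in the squared norm.\<close>
  define d where "d = sqrt (e / (16 * (2 * pi)))"
  have "d > 0" unfolding d_def using \<open>e > 0\<close> by simp
  obtain q where q: "trig_poly q" "\<And>x. x \<in> {-pi..pi} \<Longrightarrow> \<bar>h x - q x\<bar> < d"
    using trig_poly_uniformly_dense[OF continuous_on_subset[OF h(1)] _ \<open>d > 0\<close>] h by auto
  have L: "v \<in> L2_torus" "h \<in> L2_torus" "q \<in> L2_torus"
    using L2_bounded[OF vm vb] h(1) q(1) by (auto intro: L2_continuous trig_poly_continuous)
  have hq: "torus_integral (\<lambda>x. (h x - q x)\<^sup>2) \<le> e / 16"
  proof -
    have "torus_integral (\<lambda>x. (h x - q x)\<^sup>2) \<le> torus_integral (\<lambda>x. d\<^sup>2)"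
      unfolding torus_integral_eq
    proof (rule integral_mono)
      show "(h x - q x)\<^sup>2 \<le> d\<^sup>2" if "x \<in> space torus_measure" for x
        using q(2)[of x] that by (auto simp: abs_le_square_iff[symmetric])
    qed (use L2_diff[OF L(2,3)] in \<open>auto simp: L2_torus_iff\<close>)
    also have "\<dots> = e / 16"
      using \<open>e > 0\<close> unfolding torus_integral_const d_def by simp
    finally show ?thesis .
  qed
  have "torus_integral (\<lambda>x. (w x - q x)\<^sup>2) = torus_integral (\<lambda>x. ((w x - v x) + (v x - q x))\<^sup>2)"
    by simp
  also have "\<dots> \<le> 2 * torus_integral (\<lambda>x. (w x - v x)\<^sup>2) + 2 * torus_integral (\<lambda>x. (v x - q x)\<^sup>2)"
    using w L by (intro torus_integral_square_le L2_diff)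
  finally have 1: "torus_integral (\<lambda>x. (w x - q x)\<^sup>2) \<le> \<dots>" .
  have "torus_integral (\<lambda>x. (v x - q x)\<^sup>2) = torus_integral (\<lambda>x. ((v x - h x) + (h x - q x))\<^sup>2)"
    by simp
  also have "\<dots> \<le> 2 * torus_integral (\<lambda>x. (v x - h x)\<^sup>2) + 2 * torus_integral (\<lambda>x. (h x - q x)\<^sup>2)"
    using L by (intro torus_integral_square_le L2_diff)
  finally have "torus_integral (\<lambda>x. (w x - q x)\<^sup>2) < e"
    using 1 R h(4) hq \<open>e > 0\<close> unfolding v_def by linarith
  then show thesis using that q(1) by blast
qed

section \<open>Weak derivatives on the torus\<close>
lemma test_has_deriv:
  assumes "\<psi> \<in> test_functions_torus"
  shows "(\<psi> has_real_derivative deriv \<psi> x) (at x)"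
proof -
  have "((deriv ^^ 0) \<psi>) field_differentiable (at x)"
    using assms unfolding test_functions_torus_def by blast
  then show ?thesis by (simp add: DERIV_deriv_iff_field_differentiable)
qed

lemma test_deriv_continuous:
  assumes "\<psi> \<in> test_functions_torus"
  shows "continuous_on S (deriv \<psi>)"
proof -
  have "((deriv ^^ 1) \<psi>) field_differentiable (at x)" for x
    using assms unfolding test_functions_torus_def by blast
  then show ?thesis
    by (auto intro!: continuous_at_imp_continuous_on field_differentiable_imp_continuous_at)
qed

lemma test_continuous: "\<psi> \<in> test_functions_torus \<Longrightarrow> continuous_on S \<psi>"
  by (meson DERIV_isCont continuous_at_imp_continuous_on test_has_deriv)

lemma test_L2: "\<psi> \<in> test_functions_torus \<Longrightarrow> \<psi> \<in> L2_torus"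
  by (rule L2_continuous[OF test_continuous])

lemma test_deriv_L2: "\<psi> \<in> test_functions_torus \<Longrightarrow> deriv \<psi> \<in> L2_torus"
  by (rule L2_continuous[OF test_deriv_continuous])

lemma periodic_ends: "periodic_2pi u \<Longrightarrow> u pi = u (-pi)"
  unfolding periodic_2pi_def by (drule spec[of _ "-pi"]) simp

lemma test_periodic: "\<psi> \<in> test_functions_torus \<Longrightarrow> periodic_2pi \<psi>"
  by (simp add: test_functions_torus_def)

text \<open>The representative does not depend on the function, so that identities between several periodic
  functions can be transferred from one period to the whole line.\<close>
lemma torus_representative:
  obtains y where "y \<in> {-pi..<pi}" "\<And>u. periodic_2pi u \<Longrightarrow> u x = u y"
proof -
  define n where "n = \<lfloor>(x + pi) / (2 * pi)\<rfloor>"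
  define y where "y = x - of_int n * (2 * pi)"
  have "of_int n \<le> (x + pi) / (2 * pi)" "(x + pi) / (2 * pi) < of_int n + 1"
    unfolding n_def by linarith+
  then have "y \<in> {-pi..<pi}"
    unfolding y_def by (auto simp: field_simps)
  moreover have "u x = u y" if "periodic_2pi u" for u
  proof -
    interpret periodic_fun_simple u "2 * pi"
      by standard (use that in \<open>simp add: periodic_2pi_def\<close>)
    show ?thesis using plus_of_int[of y n] by (simp add: y_def)
  qed
  ultimately show thesis by (rule that)
qed

lemma periodic_eqI:
  assumes "periodic_2pi u" "periodic_2pi v" "\<And>x. x \<in> {-pi..<pi} \<Longrightarrow> u x = v x"
  shows "u x = v x"
  using assms by (metis torus_representative)

lemma continuous_AE_zero:
  fixes f :: "real \<Rightarrow> real"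
  assumes f: "continuous_on UNIV f" and ae: "AE x in torus_measure. f x = 0" and x: "x \<in> {-pi..<pi}"
  shows "f x = 0"
proof (rule ccontr)
  assume "f x \<noteq> 0"
  then have "eventually (\<lambda>y. f y \<noteq> 0) (at x)"
    using f by (intro tendsto_imp_eventually_ne[of f "f x"]) (auto simp: continuous_on_def)
  then obtain d where d: "d > 0" "\<And>y. y \<noteq> x \<Longrightarrow> dist y x < d \<Longrightarrow> f y \<noteq> 0"
    by (auto simp: eventually_at)
  define b where "b = min pi (x + d)"
  have "x < b" using x d by (auto simp: b_def)
  have "AE y in lborel. y \<notin> {x<..<b}"
    using ae unfolding AE_torus_iff
  proof eventually_elim
    case (elim y)
    then show ?case using d(2)[of y] x by (auto simp: b_def dist_real_def)
  qed
  then have "{x<..<b} \<in> null_sets lborel" by (subst AE_iff_null_sets) auto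
  then show False using \<open>x < b\<close> by (simp add: null_sets_def)
qed

lemma torus_integral_interval: "torus_integral u = (LBINT y=-pi..pi. u y)"
  unfolding torus_integral_def by (subst interval_integral_Ico) auto

lemma primitive_has_deriv_on:
  fixes f :: "real \<Rightarrow> real"
  assumes U: "open U" "convex U" "a \<in> U" "x \<in> U" and f: "continuous_on U f"
  shows "((\<lambda>x. LBINT y=ereal a..ereal x. f y) has_real_derivative f x) (at x)"
proof -
  obtain d1 where d1: "d1 > 0" "cball a d1 \<subseteq> U" using U open_contains_cball by blast
  obtain d2 where d2: "d2 > 0" "cball x d2 \<subseteq> U" using U open_contains_cball by blast
  define d where "d = min d1 d2"
  have "d > 0" using d1 d2 by (simp add: d_def)
  let ?l = "min a x - d" and ?u = "max a x + d"
  have "?l \<in> cball a d1 \<union> cball x d2" "?u \<in> cball a d1 \<union> cball x d2"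
    using \<open>d > 0\<close> by (auto simp: d_def dist_real_def min_def max_def split: if_splits)
  then have lu: "?l \<in> U" "?u \<in> U" using d1 d2 by blast+
  have sub: "{?l..?u} \<subseteq> U"
    using closed_segment_subset[OF lu U(2)] \<open>d > 0\<close> by (auto simp: closed_segment_eq_real_ivl split: if_splits)
  have "((\<lambda>u. LBINT y=a..u. f y) has_vector_derivative (f x)) (at x within {?l..?u})"
    using \<open>d > 0\<close> by (intro interval_integral_FTC2 continuous_on_subset[OF f sub]) auto
  moreover have "at x within {?l..?u} = at x"
    using \<open>d > 0\<close> by (intro at_within_interior) (auto simp: interior_atLeastAtMost_real)
  ultimately show ?thesis by (simp add: has_real_derivative_iff_has_vector_derivative)
qed

lemma primitive_has_deriv:
  fixes f :: "real \<Rightarrow> real"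
  assumes "continuous_on UNIV f"
  shows "((\<lambda>x. LBINT y=ereal a..ereal x. f y) has_real_derivative f x) (at x)"
  by (rule primitive_has_deriv_on[OF open_UNIV convex_UNIV _ _ assms]) simp_all

lemma integral_of_deriv:
  fixes f :: "real \<Rightarrow> real"
  assumes "continuous_on UNIV f" "\<And>x. (F has_real_derivative f x) (at x)"
  shows "(LBINT y=ereal a..ereal b. f y) = F b - F a"
proof (rule interval_integral_FTC_finite)
  fix x
  show "(F has_vector_derivative f x) (at x within {min a b..max a b})"
    using assms(2)[of x] by (simp add: has_real_derivative_iff_has_vector_derivative has_vector_derivative_at_within)
qed (rule continuous_on_subset[OF assms(1) subset_UNIV])

lemma torus_integral_of_deriv:
  fixes f :: "real \<Rightarrow> real"
  assumes "continuous_on UNIV f" "\<And>x. (F has_real_derivative f x) (at x)"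
  shows "torus_integral f = F pi - F (-pi)"
  using integral_of_deriv[OF assms, of "-pi" pi] by (simp add: torus_integral_interval)

lemma primitive_periodic:
  fixes f :: "real \<Rightarrow> real"
  assumes f: "continuous_on UNIV f" "periodic_2pi f" "torus_integral f = 0"
  shows "periodic_2pi (\<lambda>x. LBINT y=ereal (-pi)..ereal x. f y)"
proof -
  define P where "P x = (LBINT y=ereal (-pi)..ereal x. f y)" for x
  have P: "(P has_real_derivative f x) (at x)" for x
    unfolding P_def by (rule primitive_has_deriv[OF f(1)])
  have "((\<lambda>x. P (x + 2 * pi) - P x) has_real_derivative 0) (at x)" for x
    using f(2) by (auto intro!: derivative_eq_intros DERIV_chain2[OF P] P simp: periodic_2pi_def)
  then have "P (x + 2 * pi) - P x = P (-pi + 2 * pi) - P (-pi)" for x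
    using DERIV_isconst_all[of "\<lambda>x. P (x + 2 * pi) - P x"] by blast
  moreover have "P (-pi + 2 * pi) - P (-pi) = 0"
    using torus_integral_of_deriv[OF f(1) P] f(3) by simp
  ultimately show ?thesis
    by (auto simp: periodic_2pi_def P_def)
qed

text \<open>If \<open>q\<close> is orthogonal to \<open>v\<close>, then \<open>\<parallel>v - q\<parallel>\<^sup>2 = \<parallel>v\<parallel>\<^sup>2 + \<parallel>q\<parallel>\<^sup>2 \<ge> \<parallel>v\<parallel>\<^sup>2\<close>;
  but the left-hand side can be made arbitrarily small.\<close>
lemma L2_orthogonal_zero:
  assumes v: "v \<in> L2_torus" and orth: "\<And>q. trig_poly q \<Longrightarrow> torus_integral (\<lambda>x. v x * q x) = 0"
  shows "AE x in torus_measure. v x = 0"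
proof -
  have "torus_integral (\<lambda>x. (v x)\<^sup>2) \<le> 0 + e" if "e > 0" for e
  proof -
    obtain q where q: "trig_poly q" "torus_integral (\<lambda>x. (v x - q x)\<^sup>2) < e"
      using trig_poly_dense_L2[OF v \<open>e > 0\<close>] by blast
    have qL: "q \<in> L2_torus" using q(1) by (intro L2_continuous trig_poly_continuous)
    have "torus_integral (\<lambda>x. (v x - q x)\<^sup>2) = torus_integral (\<lambda>x. (v x)\<^sup>2 - 2 * (v x * q x) + (q x)\<^sup>2)"
      by (simp add: power2_diff algebra_simps)
    also have "\<dots> = torus_integral (\<lambda>x. (v x)\<^sup>2) - 2 * torus_integral (\<lambda>x. v x * q x) + torus_integral (\<lambda>x. (q x)\<^sup>2)"
      unfolding torus_integral_eq
      by (simp add: L2_integrable_square v qL L2_mult_integrable)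
    finally show ?thesis using q orth[OF q(1)] torus_integral_nonneg[of "\<lambda>x. (q x)\<^sup>2"] by simp
  qed
  then have "torus_integral (\<lambda>x. (v x)\<^sup>2) \<le> 0" by (rule field_le_epsilon)
  then have "torus_integral (\<lambda>x. (v x)\<^sup>2) = 0"
    using torus_integral_nonneg[of "\<lambda>x. (v x)\<^sup>2"] by simp
  then have "AE x in torus_measure. (v x)\<^sup>2 = 0"
    unfolding torus_integral_eq
    by (subst (asm) integral_nonneg_eq_0_iff_AE) (use v in \<open>auto simp: L2_torus_iff\<close>)
  then show ?thesis by simp
qed

text \<open>Stated for two almost everywhere equal functions, so that it also covers the derivative of an
  arbitrarily chosen first weak derivative.\<close>
lemma weak_deriv_unique:
  assumes "has_weak_deriv u v" "has_weak_deriv u' v'" "AE x in torus_measure. u x = u' x"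
  shows "AE x in torus_measure. v x = v' x"
proof -
  have L: "v \<in> L2_torus" "v' \<in> L2_torus" "u \<in> L2_torus" "u' \<in> L2_torus"
    using assms by (auto simp: has_weak_deriv_def)
  have "AE x in torus_measure. v x - v' x = 0"
  proof (rule L2_orthogonal_zero[OF L2_diff[OF L(1,2)]])
    fix q assume "trig_poly q"
    then have q: "q \<in> test_functions_torus" by (rule trig_poly_test)
    have dL: "deriv q \<in> L2_torus" and qL: "q \<in> L2_torus"
      using q by (auto intro: test_deriv_L2 test_L2)
    have "torus_integral (\<lambda>x. (v x - v' x) * q x)
        = torus_integral (\<lambda>x. v x * q x) - torus_integral (\<lambda>x. v' x * q x)"
      unfolding torus_integral_eq
      by (simp add: left_diff_distrib L2_mult_integrable L qL)
    also have "\<dots> = torus_integral (\<lambda>x. u' x * deriv q x) - torus_integral (\<lambda>x. u x * deriv q x)"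
      using assms(1,2) q by (auto simp: has_weak_deriv_def)
    also have "torus_integral (\<lambda>x. u' x * deriv q x) = torus_integral (\<lambda>x. u x * deriv q x)"
      unfolding torus_integral_eq
    proof (rule integral_cong_AE)
      show "AE x in torus_measure. u' x * deriv q x = u x * deriv q x"
        using assms(3) by eventually_elim simp
    qed (use L2_mult_integrable L dL in auto)
    finally show "torus_integral (\<lambda>x. (v x - v' x) * q x) = 0" by simp
  qed
  then show ?thesis by simp
qed

text \<open>For a trigonometric polynomial \<open>q\<close> with mean \<open>m\<close>, the primitive of \<open>q - m\<close> is periodic and
  therefore a test function. The hypothesis for it says that \<open>u\<close> minus its mean is orthogonal to \<open>q\<close>.\<close>
lemma du_Bois_Reymond:
  assumes u: "u \<in> L2_torus"
    and zero: "\<And>\<psi>. \<psi> \<in> test_functions_torus \<Longrightarrow> torus_integral (\<lambda>x. u x * deriv \<psi> x) = 0"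
  obtains c where "AE x in torus_measure. u x = c"
proof -
  define c where "c = torus_integral u / (2 * pi)"
  have "AE x in torus_measure. u x - c = 0"
  proof (rule L2_orthogonal_zero[OF L2_diff[OF u L2_const]])
    fix q assume q: "trig_poly q"
    define m where "m = torus_integral q / (2 * pi)"
    define \<psi> where "\<psi> x = (LBINT y=ereal (-pi)..ereal x. q y - m)" for x
    have qL: "q \<in> L2_torus" by (intro L2_continuous trig_poly_continuous q)
    have trig: "trig_poly (\<lambda>x. q x - m)"
      using trig_poly.add[OF q trig_poly.const[of "-m"]] by simp
    have "torus_integral (\<lambda>x. q x - m) = torus_integral q - torus_integral (\<lambda>x. m)"
      unfolding torus_integral_eq using L2_integrable[OF qL] by simp
    then have mean: "torus_integral (\<lambda>x. q x - m) = 0"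
      unfolding torus_integral_const m_def by simp
    have d: "(\<psi> has_real_derivative q x - m) (at x)" for x
      unfolding \<psi>_def by (rule primitive_has_deriv[OF trig_poly_continuous[OF trig]])
    then have deriv: "deriv \<psi> = (\<lambda>x. q x - m)" using DERIV_imp_deriv by blast
    have per: "periodic_2pi \<psi>"
      unfolding \<psi>_def using trig_poly_periodic[OF trig] mean
      by (intro primitive_periodic trig_poly_continuous trig) (auto simp: periodic_2pi_def)
    have "((deriv ^^ n) \<psi>) field_differentiable (at x)" for n x
    proof (cases n)
      case 0
      then show ?thesis using d by (auto simp: field_differentiable_def)
    next
      case (Suc k)
      then have "(deriv ^^ n) \<psi> = (deriv ^^ k) (\<lambda>x. q x - m)"
        using deriv by (simp add: funpow_Suc_right del: funpow.simps)
      then show ?thesis using trig_poly_differentiable[OF trig_poly_higher_deriv[OF trig]] by simp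
    qed
    then have "\<psi> \<in> test_functions_torus" using per by (simp add: test_functions_torus_def)
    from zero[OF this] have 0: "torus_integral (\<lambda>x. u x * (q x - m)) = 0" by (simp add: deriv)
    have i: "integrable torus_measure u" "integrable torus_measure q" "integrable torus_measure (\<lambda>x. u x * q x)"
      using u qL by (auto intro: L2_integrable L2_mult_integrable)
    have "torus_integral (\<lambda>x. u x * (q x - m)) = torus_integral (\<lambda>x. u x * q x) - torus_integral u * m"
      using i unfolding torus_integral_eq by (simp add: right_diff_distrib)
    moreover have "torus_integral (\<lambda>x. (u x - c) * q x) = torus_integral (\<lambda>x. u x * q x) - c * torus_integral q"
      using i unfolding torus_integral_eq by (simp add: left_diff_distrib)
    ultimately show "torus_integral (\<lambda>x. (u x - c) * q x) = 0"
      using 0 by (simp add: c_def m_def)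
  qed
  then show thesis using that by simp
qed

lemma torus_integral_upto:
  assumes x: "x \<in> {-pi..<pi}"
  shows "(LBINT y=ereal (-pi)..ereal x. w y) = torus_integral (\<lambda>y. indicator {..x} y * w y)"
proof -
  have "(LBINT y=ereal (-pi)..ereal x. w y) = (LBINT y:{-pi..x}. w y)"
    using x by (subst interval_integral_Icc) auto
  also have "\<dots> = torus_integral (\<lambda>y. indicator {..x} y * w y)"
    unfolding torus_integral_def set_lebesgue_integral_def
    using x by (intro Bochner_Integration.integral_cong) (auto simp: indicator_def)
  finally show ?thesis .
qed

lemma torus_integral_from:
  assumes x: "x \<in> {-pi..<pi}"
  shows "(LBINT y=ereal x..ereal pi. w y) = torus_integral (\<lambda>y. indicator {x..} y * w y)"
proof -
  have "(LBINT y=ereal x..ereal pi. w y) = (LBINT y:{x..<pi}. w y)"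
    using x by (subst interval_integral_Ico) auto
  also have "\<dots> = torus_integral (\<lambda>y. indicator {x..} y * w y)"
    unfolding torus_integral_def set_lebesgue_integral_def
    using x by (intro Bochner_Integration.integral_cong) (auto simp: indicator_def)
  finally show ?thesis .
qed

text \<open>Integration by parts with one factor only absolutely continuous: insert the integral that
  defines \<open>V\<close> and exchange the order of integration over the triangle \<open>y \<le> x\<close>.\<close>
lemma primitive_integration_by_parts:
  assumes w: "w \<in> L2_torus"
    and V: "\<And>x. x \<in> {-pi..<pi} \<Longrightarrow> V x = c + (LBINT y=ereal (-pi)..ereal x. w y)"
    and mean: "torus_integral w = 0"
    and \<theta>: "\<And>x. (\<theta> has_real_derivative \<theta>' x) (at x)" "continuous_on UNIV \<theta>'" "\<theta> pi = \<theta> (-pi)"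
  shows "torus_integral (\<lambda>x. V x * \<theta>' x) = - torus_integral (\<lambda>x. w x * \<theta> x)"
proof -
  interpret pair_sigma_finite torus_measure torus_measure ..
  have wm[measurable]: "w \<in> borel_measurable borel" using w by (simp add: L2_torus_iff)
  have cm[measurable]: "\<theta>' \<in> borel_measurable borel" using \<theta>(2) by (rule borel_measurable_continuous_onI)
  have wm'[measurable]: "w \<in> borel_measurable torus_measure" "\<theta>' \<in> borel_measurable torus_measure"
    by (auto intro: measurable_torus wm cm)
  have c\<theta>: "continuous_on UNIV \<theta>"
    using \<theta>(1) by (meson DERIV_isCont continuous_at_imp_continuous_on)
  have \<theta>L: "\<theta> \<in> L2_torus" "\<theta>' \<in> L2_torus" by (auto intro: L2_continuous c\<theta> \<theta>(2))
  have iw: "integrable torus_measure w" by (rule L2_integrable[OF w])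
  have ic: "integrable torus_measure \<theta>'" by (rule L2_integrable[OF \<theta>L(2)])
  define k where "k x y = (indicator {(x, y). y \<le> x} (x, y) :: real) * (w y * \<theta>' x)" for x y
  have km: "(\<lambda>(x, y). k x y) \<in> borel_measurable (torus_measure \<Otimes>\<^sub>M torus_measure)"
  proof -
    have [measurable]: "fst \<in> borel_measurable (torus_measure \<Otimes>\<^sub>M torus_measure)"
       "snd \<in> borel_measurable (torus_measure \<Otimes>\<^sub>M torus_measure)"
      by (auto intro!: measurable_fst'' measurable_snd'' measurable_torus)
    have "(\<lambda>p. (if snd p \<le> fst p then 1 else 0) * (w (snd p) * \<theta>' (fst p))) \<in> borel_measurable (torus_measure \<Otimes>\<^sub>M torus_measure)"
      by measurable
    then show ?thesis by (simp add: k_def split_beta' indicator_def)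
  qed
  have prod: "integrable (torus_measure \<Otimes>\<^sub>M torus_measure) (\<lambda>(x, y). w y * \<theta>' x)"
  proof (rule Fubini_integrable)
    show "(\<lambda>(x, y). w y * \<theta>' x) \<in> borel_measurable (torus_measure \<Otimes>\<^sub>M torus_measure)" by measurable
    show "integrable torus_measure (\<lambda>x. \<integral>y. norm (case (x, y) of (x, y) \<Rightarrow> w y * \<theta>' x) \<partial>torus_measure)"
      using ic iw by (simp add: abs_mult)
    show "AE x in torus_measure. integrable torus_measure (\<lambda>y. case (x, y) of (x, y) \<Rightarrow> w y * \<theta>' x)"
      using iw by simp
  qed
  have ki: "integrable (torus_measure \<Otimes>\<^sub>M torus_measure) (\<lambda>(x, y). k x y)"
    by (rule Bochner_Integration.integrable_bound[OF prod km]) (auto simp: k_def indicator_def)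
  have "torus_integral (\<lambda>x. V x * \<theta>' x) = (\<integral>x. c * \<theta>' x + (\<integral>y. k x y \<partial>torus_measure) \<partial>torus_measure)"
    unfolding torus_integral_eq
  proof (rule Bochner_Integration.integral_cong[OF refl])
    fix x assume "x \<in> space torus_measure"
    then have x: "x \<in> {-pi..<pi}" by simp
    have "(\<integral>y. k x y \<partial>torus_measure) = (\<integral>y. (indicator {..x} y * w y) * \<theta>' x \<partial>torus_measure)"
      by (intro Bochner_Integration.integral_cong) (auto simp: k_def indicator_def)
    also have "\<dots> = (LBINT y=ereal (-pi)..ereal x. w y) * \<theta>' x"
      unfolding torus_integral_upto[OF x] torus_integral_eq by simp
    finally show "V x * \<theta>' x = c * \<theta>' x + (\<integral>y. k x y \<partial>torus_measure)"
      using V[OF x] by (simp add: algebra_simps)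
  qed
  also have "\<dots> = c * torus_integral \<theta>' + (\<integral>x. (\<integral>y. k x y \<partial>torus_measure) \<partial>torus_measure)"
    unfolding torus_integral_eq using ic integrable_fst[OF ki] by simp
  also have "torus_integral \<theta>' = 0"
    using torus_integral_of_deriv[OF \<theta>(2,1)] \<theta>(3) by simp
  also have "(\<integral>x. (\<integral>y. k x y \<partial>torus_measure) \<partial>torus_measure) = (\<integral>y. (\<integral>x. k x y \<partial>torus_measure) \<partial>torus_measure)"
    using Fubini_integral[OF ki] by simp
  also have "\<dots> = torus_integral (\<lambda>y. w y * \<theta> pi - w y * \<theta> y)"
    unfolding torus_integral_eq
  proof (rule Bochner_Integration.integral_cong[OF refl])
    fix y assume "y \<in> space torus_measure"
    then have y: "y \<in> {-pi..<pi}" by simp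
    have "(\<integral>x. k x y \<partial>torus_measure) = (\<integral>x. w y * (indicator {y..} x * \<theta>' x) \<partial>torus_measure)"
      by (intro Bochner_Integration.integral_cong) (auto simp: k_def indicator_def)
    also have "\<dots> = w y * (LBINT x=ereal y..ereal pi. \<theta>' x)"
      unfolding torus_integral_from[OF y] torus_integral_eq by simp
    also have "(LBINT x=ereal y..ereal pi. \<theta>' x) = \<theta> pi - \<theta> y"
      by (rule integral_of_deriv[OF \<theta>(2,1)])
    finally show "(\<integral>x. k x y \<partial>torus_measure) = w y * \<theta> pi - w y * \<theta> y" by (simp add: right_diff_distrib)
  qed
  also have "\<dots> = torus_integral w * \<theta> pi - torus_integral (\<lambda>x. w x * \<theta> x)"
    unfolding torus_integral_eq using iw L2_mult_integrable[OF w \<theta>L(1)] by simp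
  finally show ?thesis using mean by simp
qed

lemma has_weak_deriv_C1:
  assumes u: "\<And>x. (u has_real_derivative u' x) (at x)" "continuous_on UNIV u'" "u pi = u (-pi)"
  shows "has_weak_deriv u u'"
  unfolding has_weak_deriv_def
proof (intro conjI ballI)
  have "continuous_on UNIV u"
    using u(1) by (meson DERIV_isCont continuous_at_imp_continuous_on)
  then show "u \<in> L2_torus" "u' \<in> L2_torus" using u(2) by (auto intro: L2_continuous)
  fix \<psi> assume \<psi>: "\<psi> \<in> test_functions_torus"
  show "torus_integral (\<lambda>x. u x * deriv \<psi> x) = - torus_integral (\<lambda>x. u' x * \<psi> x)"
  proof (rule primitive_integration_by_parts[where c = "u (-pi)"])
    show "u x = u (-pi) + (LBINT y=ereal (-pi)..ereal x. u' y)" for x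
      using integral_of_deriv[OF u(2,1), of "-pi" x] by simp
    show "torus_integral u' = 0"
      using torus_integral_of_deriv[OF u(2,1)] u(3) by simp
    show "\<psi> pi = \<psi> (-pi)" by (rule periodic_ends[OF test_periodic[OF \<psi>]])
  qed (auto intro: test_has_deriv test_deriv_continuous \<psi> \<open>u' \<in> L2_torus\<close>)
qed

lemma has_weak_deriv_diff:
  assumes "has_weak_deriv u v" "has_weak_deriv u' v'"
  shows "has_weak_deriv (\<lambda>x. u x - u' x) (\<lambda>x. v x - v' x)"
  unfolding has_weak_deriv_def
proof (intro conjI ballI)
  have L: "v \<in> L2_torus" "v' \<in> L2_torus" "u \<in> L2_torus" "u' \<in> L2_torus"
    using assms by (auto simp: has_weak_deriv_def)
  then show "(\<lambda>x. u x - u' x) \<in> L2_torus" "(\<lambda>x. v x - v' x) \<in> L2_torus" by (auto intro: L2_diff)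
  fix \<psi> assume \<psi>: "\<psi> \<in> test_functions_torus"
  have "\<psi> \<in> L2_torus" "deriv \<psi> \<in> L2_torus"
    using \<psi> by (auto intro: test_deriv_L2 test_L2)
  then have "integrable torus_measure (\<lambda>x. u x * deriv \<psi> x)" "integrable torus_measure (\<lambda>x. u' x * deriv \<psi> x)"
    "integrable torus_measure (\<lambda>x. v x * \<psi> x)" "integrable torus_measure (\<lambda>x. v' x * \<psi> x)"
    using L by (auto intro: L2_mult_integrable)
  moreover have "torus_integral (\<lambda>x. u x * deriv \<psi> x) = - torus_integral (\<lambda>x. v x * \<psi> x)"
    "torus_integral (\<lambda>x. u' x * deriv \<psi> x) = - torus_integral (\<lambda>x. v' x * \<psi> x)"
    using assms \<psi> by (auto simp: has_weak_deriv_def)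
  ultimately show "torus_integral (\<lambda>x. (u x - u' x) * deriv \<psi> x) = - torus_integral (\<lambda>x. (v x - v' x) * \<psi> x)"
    unfolding torus_integral_eq by (simp add: left_diff_distrib)
qed

lemma L2_norm_torus_sq: "(L2_norm_torus u)\<^sup>2 = torus_integral (\<lambda>x. (u x)\<^sup>2)"
  unfolding L2_norm_torus_def by (rule real_sqrt_pow2) (simp add: torus_integral_nonneg)

text \<open>The norm is defined through arbitrarily chosen weak derivatives. By uniqueness it can be
  computed from any pair of weak derivatives.\<close>
lemma H2_norm_torus_eq:
  assumes "has_weak_deriv u v" "has_weak_deriv v w"
  shows "H2_norm_torus u = sqrt (torus_integral (\<lambda>x. (u x)\<^sup>2) + torus_integral (\<lambda>x. (v x)\<^sup>2)
    + torus_integral (\<lambda>x. (w x)\<^sup>2))"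
proof -
  have 1: "has_weak_deriv u (weak_deriv u)"
    unfolding weak_deriv_def by (rule someI[of "has_weak_deriv u"]) (rule assms)
  have ae: "AE x in torus_measure. weak_deriv u x = v x"
    using weak_deriv_unique[OF 1 assms(1)] by simp
  have L: "weak_deriv u \<in> L2_torus" "v \<in> L2_torus" "w \<in> L2_torus"
    using 1 assms by (auto simp: has_weak_deriv_def)
  have "has_weak_deriv (weak_deriv u) w"
    unfolding has_weak_deriv_def
  proof (intro conjI ballI)
    fix \<psi> assume \<psi>: "\<psi> \<in> test_functions_torus"
    have dL: "deriv \<psi> \<in> L2_torus"
      by (rule test_deriv_L2[OF \<psi>])
    have "torus_integral (\<lambda>x. weak_deriv u x * deriv \<psi> x) = torus_integral (\<lambda>x. v x * deriv \<psi> x)"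
      unfolding torus_integral_eq
    proof (rule integral_cong_AE)
      show "AE x in torus_measure. weak_deriv u x * deriv \<psi> x = v x * deriv \<psi> x"
        using ae by eventually_elim simp
    qed (use L2_mult_integrable L dL in auto)
    then show "torus_integral (\<lambda>x. weak_deriv u x * deriv \<psi> x) = - torus_integral (\<lambda>x. w x * \<psi> x)"
      using assms(2) \<psi> by (simp add: has_weak_deriv_def)
  qed (use L in auto)
  then have 2: "has_weak_deriv (weak_deriv u) (weak_deriv (weak_deriv u))"
    unfolding weak_deriv_def[of "weak_deriv u"] by (rule someI[of "has_weak_deriv (weak_deriv u)"])
  have ae2: "AE x in torus_measure. weak_deriv (weak_deriv u) x = w x"
    using weak_deriv_unique[OF 2 assms(2) ae] .
  have "weak_deriv (weak_deriv u) \<in> L2_torus" using 2 by (simp add: has_weak_deriv_def)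
  then show ?thesis
    unfolding H2_norm_torus_def L2_norm_torus_sq
    using torus_integral_square_cong_AE[OF L(1,2) ae] torus_integral_square_cong_AE[OF _ L(3) ae2] by simp
qed

lemma one_test: "(\<lambda>x. 1) \<in> test_functions_torus"
  by (rule trig_poly_test[OF trig_poly.const])

lemma weak_deriv_mean_zero:
  assumes "has_weak_deriv u v"
  shows "torus_integral v = 0"
proof -
  have "torus_integral (\<lambda>x. u x * deriv (\<lambda>x. 1) x) = - torus_integral (\<lambda>x. v x * 1)"
    using assms one_test unfolding has_weak_deriv_def by blast
  then show ?thesis by (simp add: torus_integral_eq)
qed

lemma weak_deriv_determines_up_to_const:
  assumes "has_weak_deriv u v" "U \<in> L2_torus"
    and "\<And>\<psi>. \<psi> \<in> test_functions_torus \<Longrightarrow> torus_integral (\<lambda>x. U x * deriv \<psi> x) = - torus_integral (\<lambda>x. v x * \<psi> x)"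
  obtains c where "AE x in torus_measure. u x = U x + c"
proof -
  have uL: "u \<in> L2_torus" using assms(1) by (simp add: has_weak_deriv_def)
  have "torus_integral (\<lambda>x. (u x - U x) * deriv \<psi> x) = 0" if \<psi>: "\<psi> \<in> test_functions_torus" for \<psi>
  proof -
    have "deriv \<psi> \<in> L2_torus" by (rule test_deriv_L2[OF \<psi>])
    then have "torus_integral (\<lambda>x. (u x - U x) * deriv \<psi> x)
      = torus_integral (\<lambda>x. u x * deriv \<psi> x) - torus_integral (\<lambda>x. U x * deriv \<psi> x)"
      unfolding torus_integral_eq by (simp add: left_diff_distrib L2_mult_integrable uL assms(2))
    then show ?thesis using assms(1,3) \<psi> by (simp add: has_weak_deriv_def)
  qed
  then obtain c where "AE x in torus_measure. u x - U x = c"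
    using du_Bois_Reymond[OF L2_diff[OF uL assms(2)]] by blast
  then have "AE x in torus_measure. u x = U x + c" by eventually_elim simp
  then show thesis by (rule that)
qed

lemma set_integrable_closed_torus:
  fixes k :: "real \<Rightarrow> real"
  assumes "integrable torus_measure k"
  shows "set_integrable lborel {-pi..pi} k"
proof -
  have "set_integrable lborel {-pi..<pi} k" using assms by (simp add: integrable_torus_iff)
  moreover have "set_integrable lborel {-pi..<pi} k \<longleftrightarrow> set_integrable lborel {-pi..pi} k"
    by (intro set_integrable_discrete_difference[where X="{pi}"]) auto
  ultimately show ?thesis by simp
qed

lemma primitive_continuous:
  assumes "w \<in> L2_torus"
  shows "continuous_on {-pi..pi} (\<lambda>x. LBINT y=ereal (-pi)..ereal x. w y)"
proof -
  have i: "set_integrable lborel {-pi..pi} w"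
    by (rule set_integrable_closed_torus[OF L2_integrable[OF assms]])
  have "continuous_on {-pi..pi} (\<lambda>x. integral {-pi..x} w)"
    using set_borel_integral_eq_integral(1)[OF i] by (rule indefinite_integral_continuous_1)
  moreover have "integral {-pi..x} w = (LBINT y=ereal (-pi)..ereal x. w y)" if "x \<in> {-pi..pi}" for x
    using that by (subst interval_integral_eq_integral) (auto intro: set_integrable_subset[OF i])
  ultimately show ?thesis by (rule continuous_on_eq)
qed

text \<open>Both weak derivatives are compared with a primitive of the next one: the primitive has the same
  weak derivative by integration by parts, so the difference is constant. The primitive of the
  second weak derivative has equal values at both ends of the period, which is what allows its
  continuous periodic extension \<open>\<phi>'\<close>; for \<open>\<phi>\<close> itself, continuity upgrades equality almost everywhere
  to equality everywhere.\<close>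
lemma H2_torus_classical:
  assumes "\<phi> \<in> H2_torus"
  obtains \<phi>' w where "\<And>x. (\<phi> has_real_derivative \<phi>' x) (at x)" "continuous_on UNIV \<phi>'" "periodic_2pi \<phi>'"
    "w \<in> L2_torus" "torus_integral w = 0"
    "\<And>x. x \<in> {-pi..pi} \<Longrightarrow> \<phi>' x = \<phi>' (-pi) + (LBINT y=ereal (-pi)..ereal x. w y)"
proof -
  obtain v w where vw: "has_weak_deriv \<phi> v" "has_weak_deriv v w"
    and \<phi>: "continuous_on UNIV \<phi>" "periodic_2pi \<phi>"
    using assms by (auto simp: H2_torus_def)
  have L: "v \<in> L2_torus" "w \<in> L2_torus" using vw by (auto simp: has_weak_deriv_def)
  have w0: "torus_integral w = 0" and v0: "torus_integral v = 0"
    using vw by (auto intro: weak_deriv_mean_zero)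
  obtain V where V: "continuous_on UNIV V" "periodic_2pi V"
    "\<And>x. x \<in> {-pi..pi} \<Longrightarrow> V x = (LBINT y=ereal (-pi)..ereal x. w y)"
  proof (rule periodic_extension[OF primitive_continuous[OF L(2)]])
    show "(LBINT y=ereal (-pi)..ereal (-pi). w y) = (LBINT y=ereal (-pi)..ereal pi. w y)"
      using w0 by (simp add: torus_integral_interval)
  qed blast
  have "torus_integral (\<lambda>x. V x * deriv \<psi> x) = - torus_integral (\<lambda>x. w x * \<psi> x)"
    if \<psi>: "\<psi> \<in> test_functions_torus" for \<psi>
    by (rule primitive_integration_by_parts[where c=0])
       (use V L w0 periodic_ends[OF test_periodic[OF \<psi>]] in \<open>auto intro: test_has_deriv test_deriv_continuous \<psi>\<close>)
  then obtain c where c: "AE x in torus_measure. v x = V x + c"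
    using weak_deriv_determines_up_to_const[OF vw(2) L2_continuous[OF V(1)]] by blast
  define \<phi>' where "\<phi>' x = V x + c" for x
  have c': "continuous_on UNIV \<phi>'" unfolding \<phi>'_def by (intro continuous_intros V(1))
  have p': "periodic_2pi \<phi>'" using V(2) by (simp add: \<phi>'_def periodic_2pi_def)
  have L': "\<phi>' \<in> L2_torus" using c' by (rule L2_continuous)
  have ae: "AE x in torus_measure. \<phi>' x = v x"
    using c by eventually_elim (simp add: \<phi>'_def)
  have "torus_integral \<phi>' = torus_integral v"
    unfolding torus_integral_eq using ae L L2_integrable[OF L'] L2_integrable[OF L(1)]
    by (intro integral_cong_AE) auto
  then have m': "torus_integral \<phi>' = 0" using v0 by simp
  define P where "P x = (LBINT y=ereal (-pi)..ereal x. \<phi>' y)" for x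
  have P: "(P has_real_derivative \<phi>' x) (at x)" for x
    unfolding P_def by (rule primitive_has_deriv[OF c'])
  have Pper: "periodic_2pi P" unfolding P_def by (rule primitive_periodic[OF c' p' m'])
  have Pc: "continuous_on UNIV P" using P by (meson DERIV_isCont continuous_at_imp_continuous_on)
  have "torus_integral (\<lambda>x. P x * deriv \<psi> x) = - torus_integral (\<lambda>x. v x * \<psi> x)"
    if \<psi>: "\<psi> \<in> test_functions_torus" for \<psi>
  proof -
    have \<psi>L: "\<psi> \<in> L2_torus" by (rule test_L2[OF \<psi>])
    have "torus_integral (\<lambda>x. P x * deriv \<psi> x) = - torus_integral (\<lambda>x. \<phi>' x * \<psi> x)"
      using has_weak_deriv_C1[OF P c' periodic_ends[OF Pper]] \<psi> by (simp add: has_weak_deriv_def)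
    also have "torus_integral (\<lambda>x. \<phi>' x * \<psi> x) = torus_integral (\<lambda>x. v x * \<psi> x)"
      unfolding torus_integral_eq
    proof (rule integral_cong_AE)
      show "AE x in torus_measure. \<phi>' x * \<psi> x = v x * \<psi> x"
        using ae by eventually_elim simp
    qed (use L2_mult_integrable L L' \<psi>L in auto)
    finally show ?thesis .
  qed
  then obtain b where b: "AE x in torus_measure. \<phi> x = P x + b"
    using weak_deriv_determines_up_to_const[OF vw(1) L2_continuous[OF Pc]] by blast
  have eq: "\<phi> x = P x + b" for x
  proof (rule periodic_eqI[of \<phi> "\<lambda>x. P x + b"])
    fix x assume x: "x \<in> {-pi..<pi}"
    have "AE x in torus_measure. \<phi> x - P x - b = 0" using b by eventually_elim simp
    then have "\<phi> x - P x - b = 0"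
      by (rule continuous_AE_zero[rotated]) (use x in \<open>auto intro!: continuous_intros \<phi>(1) Pc\<close>)
    then show "\<phi> x = P x + b" by simp
  qed (use \<phi>(2) Pper in \<open>auto simp: periodic_2pi_def\<close>)
  show thesis
  proof (rule that[of \<phi>' w])
    show "(\<phi> has_real_derivative \<phi>' x) (at x)" for x
      unfolding eq[abs_def] by (auto intro!: derivative_eq_intros P)
    show "\<phi>' x = \<phi>' (-pi) + (LBINT y=ereal (-pi)..ereal x. w y)" if "x \<in> {-pi..pi}" for x
      using V(3)[OF that] V(3)[of "-pi"] by (simp add: \<phi>'_def)
  qed (fact c' p' L(2) w0)+
qed

section \<open>Integrals depending on a parameter\<close>
lemma param_integral_has_deriv_le:
  fixes f f' :: "real \<Rightarrow> real \<Rightarrow> real"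
  assumes S: "open S" "convex S" "s \<in> S"
    and f: "\<And>s. s \<in> S \<Longrightarrow> continuous_on UNIV (f s)"
    and f': "continuous_on (S \<times> UNIV) (\<lambda>(s, y). f' s y)"
    and d: "\<And>s y. s \<in> S \<Longrightarrow> ((\<lambda>s. f s y) has_real_derivative f' s y) (at s)"
    and "a \<le> b"
  shows "((\<lambda>s. LBINT y=ereal a..ereal b. f s y) has_real_derivative (LBINT y=ereal a..ereal b. f' s y)) (at s)"
proof -
  have f'c: "continuous_on UNIV (f' s)" if "s \<in> S" for s
    by (rule continuous_on_compose2[OF f', where f="\<lambda>y. (s, y)", simplified])
       (use that in \<open>auto intro!: continuous_intros\<close>)
  have eq: "(LBINT y=ereal a..ereal b. h y) = integral (cbox a b) h" if "continuous_on UNIV h" for h :: "real \<Rightarrow> real"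
    using \<open>a \<le> b\<close> interval_integral_eq_integral[OF _ borel_integrable_atLeastAtMost'[OF continuous_on_subset[OF that]]] by simp
  have "((\<lambda>s. integral (cbox a b) (f s)) has_field_derivative integral (cbox a b) (f' s)) (at s within S)"
  proof (rule leibniz_rule_field_derivative[OF _ _ _ S(3,2)])
    show "((\<lambda>s. f s y) has_real_derivative f' s y) (at s within S)" if "s \<in> S" for s y
      using d[OF that] by (rule has_field_derivative_at_within)
    show "f s integrable_on cbox a b" if "s \<in> S" for s
      by (rule integrable_continuous) (rule continuous_on_subset[OF f[OF that] subset_UNIV])
    show "continuous_on (S \<times> cbox a b) (\<lambda>(s, y). f' s y)"
      by (rule continuous_on_subset[OF f']) auto
  qed
  then have "((\<lambda>s. LBINT y=ereal a..ereal b. f s y) has_field_derivative integral (cbox a b) (f' s)) (at s within S)"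
    by (rule has_field_derivative_transform_within[OF _ zero_less_one S(3)]) (simp add: eq f)
  then show ?thesis
    by (simp only: eq[OF f'c[OF S(3)]] at_within_open[OF S(3,1)])
qed

lemma param_integral_has_deriv:
  fixes f f' :: "real \<Rightarrow> real \<Rightarrow> real"
  assumes S: "open S" "convex S" "s \<in> S"
    and f: "\<And>s. s \<in> S \<Longrightarrow> continuous_on UNIV (f s)"
    and f': "continuous_on (S \<times> UNIV) (\<lambda>(s, y). f' s y)"
    and d: "\<And>s y. s \<in> S \<Longrightarrow> ((\<lambda>s. f s y) has_real_derivative f' s y) (at s)"
  shows "((\<lambda>s. LBINT y=ereal a..ereal b. f s y) has_real_derivative (LBINT y=ereal a..ereal b. f' s y)) (at s)"
proof (cases "a \<le> b")
  case True
  then show ?thesis using param_integral_has_deriv_le[OF assms] by blast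
next
  case False
  then have "b \<le> a" by simp
  have "((\<lambda>s. - (LBINT y=ereal b..ereal a. f s y)) has_real_derivative - (LBINT y=ereal b..ereal a. f' s y)) (at s)"
    by (rule DERIV_minus[OF param_integral_has_deriv_le[OF assms \<open>b \<le> a\<close>]])
  then show ?thesis
    by (simp only: interval_integral_endpoints_reverse[of "ereal a" "ereal b"])
qed

lemma param_torus_integral_continuous:
  fixes f :: "real \<Rightarrow> real \<Rightarrow> real"
  assumes f: "continuous_on (S \<times> UNIV) (\<lambda>(s, y). f s y)"
  shows "continuous_on S (\<lambda>s. torus_integral (f s))"
proof -
  have fc: "continuous_on UNIV (f s)" if "s \<in> S" for s
    by (rule continuous_on_compose2[OF f, where f="\<lambda>y. (s, y)", simplified])
       (use that in \<open>auto intro!: continuous_intros\<close>)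
  have eq: "torus_integral (f s) = integral (cbox (-pi) pi) (f s)" if "s \<in> S" for s
    using interval_integral_eq_integral[OF _ borel_integrable_atLeastAtMost'[OF continuous_on_subset[OF fc[OF that]]]]
    by (simp add: torus_integral_interval)
  have "continuous_on S (\<lambda>s. integral (cbox (-pi) pi) (f s))"
    by (rule integral_continuous_on_param) (rule continuous_on_subset[OF f], auto)
  then show ?thesis by (rule continuous_on_eq) (simp add: eq)
qed

section \<open>The flow map as a function of the new time\<close>

text \<open>The information on the initial datum on which the construction rests: \<open>\<phi>\<close> is continuously
  differentiable and periodic with zero mean, \<open>w\<close> is the density of its absolutely continuous derivative, and the
  bounds \<open>m\<close> and \<open>M\<close> delimit the parameters \<open>s\<close> for which \<open>1 - s \<phi>\<close> stays positive.\<close>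
locale zero_mean_datum =
  fixes \<phi> \<phi>' w :: "real \<Rightarrow> real" and m M :: real
  assumes \<phi>_deriv: "(\<phi> has_real_derivative \<phi>' x) (at x)"
    and \<phi>'_cont: "continuous_on UNIV \<phi>'"
    and \<phi>_periodic: "periodic_2pi \<phi>"
    and mean_zero: "torus_integral \<phi> = 0"
    and w_L2: "w \<in> L2_torus"
    and w_mean: "torus_integral w = 0"
    and \<phi>'_primitive: "x \<in> {-pi..pi} \<Longrightarrow> \<phi>' x = \<phi>' (-pi) + (LBINT y=ereal (-pi)..ereal x. w y)"
    and lower: "m \<le> \<phi> x" and upper: "\<phi> x \<le> M"
begin

lemma \<phi>_cont: "continuous_on A \<phi>"
  using \<phi>_deriv by (meson DERIV_isCont continuous_at_imp_continuous_on)

text \<open>The parameters \<open>s\<close> of the construction. As \<open>1 - s y\<close> is affine in \<open>y\<close>, positivity at the two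
  bounds gives positivity on the range of \<open>\<phi>\<close>. The set is open and contains \<open>0\<close>, so all
  derivatives in \<open>s\<close> are two-sided, even at the initial time.\<close>
definition S :: "real set" where
  "S = {s. 0 < 1 - s * m \<and> 0 < 1 - s * M}"

lemma open_S: "open S"
  unfolding S_def by (intro open_Collect_conj open_Collect_less continuous_intros)

lemma convex_S: "convex S"
proof -
  have "S = {s. m * s < 1} \<inter> {s. M * s < 1}" by (auto simp: S_def mult.commute)
  then show ?thesis
    using convex_halfspace_lt[of m 1] convex_halfspace_lt[of M 1] by (simp add: convex_Int)
qed

lemma zero_S: "0 \<in> S" by (simp add: S_def)

lemma denom_ge: "min (1 - s * m) (1 - s * M) \<le> 1 - s * \<phi> a"
proof (cases "s \<ge> 0")
  case True
  then have "s * \<phi> a \<le> s * M" using upper by (intro mult_left_mono)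
  then show ?thesis by simp
next
  case False
  then have "s * \<phi> a \<le> s * m" using lower by (intro mult_left_mono_neg) auto
  then show ?thesis by simp
qed

lemma denom_pos: "s \<in> S \<Longrightarrow> 0 < 1 - s * \<phi> a"
  using denom_ge[of s a] by (auto simp: S_def)

lemma denom_neq: "s \<in> S \<Longrightarrow> 1 - s * \<phi> a \<noteq> 0"
  using denom_pos[of s a] by simp

lemma prod_neq_1: "s \<in> S \<Longrightarrow> s * \<phi> a \<noteq> 1"
  using denom_pos[of s a] by simp

lemma frac_cont: "continuous_on (S \<times> UNIV) (\<lambda>(s, y). \<phi> y ^ j / (1 - s * \<phi> y) ^ k)"
  unfolding split_beta using denom_neq
  by (auto intro!: continuous_intros continuous_on_compose2[OF \<phi>_cont[of UNIV]])

lemma frac_cont_space: "s \<in> S \<Longrightarrow> continuous_on UNIV (\<lambda>y. \<phi> y ^ j / (1 - s * \<phi> y) ^ k)"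
  using denom_neq by (auto intro!: continuous_intros \<phi>_cont)

text \<open>All integrals that occur belong to this family, which is closed under differentiation in \<open>s\<close>.\<close>
definition J :: "nat \<Rightarrow> nat \<Rightarrow> real \<Rightarrow> real \<Rightarrow> real" where
  "J j k s a = (LBINT y=ereal (-pi)..ereal a. \<phi> y ^ j / (1 - s * \<phi> y) ^ k)"

lemma J_deriv_a: "s \<in> S \<Longrightarrow> (J j k s has_real_derivative \<phi> a ^ j / (1 - s * \<phi> a) ^ k) (at a)"
  unfolding J_def by (rule primitive_has_deriv[OF frac_cont_space])

lemma frac_deriv_s:
  assumes "s \<in> S"
  shows "((\<lambda>s. \<phi> y ^ j / (1 - s * \<phi> y) ^ k) has_real_derivative
    real k * (\<phi> y ^ Suc j / (1 - s * \<phi> y) ^ Suc k)) (at s)"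
proof (cases k)
  case 0
  then show ?thesis by simp
next
  case (Suc n)
  have "((\<lambda>s. (1 - s * \<phi> y) ^ k) has_real_derivative real k * (1 - s * \<phi> y) ^ n * (- \<phi> y)) (at s)"
  proof -
    have "((\<lambda>s. 1 - s * \<phi> y) has_real_derivative - \<phi> y) (at s)"
      by (auto intro!: derivative_eq_intros)
    from DERIV_power[OF this, of k] show ?thesis by (simp add: Suc mult_ac)
  qed
  then have "((\<lambda>s. \<phi> y ^ j / (1 - s * \<phi> y) ^ k) has_real_derivative
    (0 * (1 - s * \<phi> y) ^ k - \<phi> y ^ j * (real k * (1 - s * \<phi> y) ^ n * (- \<phi> y)))
      / ((1 - s * \<phi> y) ^ k * (1 - s * \<phi> y) ^ k)) (at s)"
    by (rule DERIV_divide[OF DERIV_const]) (rule power_not_zero[OF denom_neq[OF assms]])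
  moreover have "(0 * d ^ k - \<phi> y ^ j * (real k * d ^ n * (- \<phi> y))) / (d ^ k * d ^ k)
      = real k * (\<phi> y ^ Suc j / d ^ Suc k)" if "d \<noteq> 0" for d
    using that by (simp add: Suc field_simps)
  note this[OF denom_neq[OF assms, of y]]
  ultimately show ?thesis by (simp only:)
qed

lemma J_deriv_s:
  assumes "s \<in> S"
  shows "((\<lambda>s. J j k s a) has_real_derivative real k * J (Suc j) (Suc k) s a) (at s)"
proof -
  have "((\<lambda>s. J j k s a) has_real_derivative
     (LBINT y=ereal (-pi)..ereal a. real k * (\<phi> y ^ Suc j / (1 - s * \<phi> y) ^ Suc k))) (at s)"
    unfolding J_def
  proof (rule param_integral_has_deriv[OF open_S convex_S assms])
    show "continuous_on (S \<times> UNIV) (\<lambda>(s, y). real k * (\<phi> y ^ Suc j / (1 - s * \<phi> y) ^ Suc k))"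
      using continuous_on_mult_left[OF frac_cont[of "Suc j" "Suc k"], of "real k"] by (simp add: split_beta)
    show "((\<lambda>s. \<phi> y ^ j / (1 - s * \<phi> y) ^ k) has_real_derivative
        real k * (\<phi> y ^ Suc j / (1 - s * \<phi> y) ^ Suc k)) (at s)" if "s \<in> S" for s y
      by (rule frac_deriv_s[OF that])
  qed (rule frac_cont_space)
  moreover have "(LBINT y=ereal (-pi)..ereal a. real k * (\<phi> y ^ Suc j / (1 - s * \<phi> y) ^ Suc k))
      = real k * J (Suc j) (Suc k) s a"
    unfolding J_def by (rule interval_lebesgue_integral_mult_right)
  ultimately show ?thesis by (simp only:)
qed

lemma torus_integral_frac: "torus_integral (\<lambda>y. \<phi> y ^ j / (1 - s * \<phi> y) ^ k) = J j k s pi"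
  by (simp add: J_def torus_integral_interval)

text \<open>\<open>K\<close> is the mean of \<open>1 / (1 - s \<phi>)\<close>; \<open>K1\<close> and \<open>K2\<close> are its first two derivatives.\<close>
definition K :: "real \<Rightarrow> real" where "K s = J 0 1 s pi / (2 * pi)"
definition K1 :: "real \<Rightarrow> real" where "K1 s = J 1 2 s pi / (2 * pi)"
definition K2 :: "real \<Rightarrow> real" where "K2 s = 2 * J 2 3 s pi / (2 * pi)"

lemma K_deriv: "s \<in> S \<Longrightarrow> (K has_real_derivative K1 s) (at s)"
  unfolding K_def[abs_def] K1_def using DERIV_cdivide[OF J_deriv_s[of s 0 1 pi]]
  by (simp add: numeral_2_eq_2)

lemma K1_deriv: "s \<in> S \<Longrightarrow> (K1 has_real_derivative K2 s) (at s)"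
  unfolding K1_def[abs_def] K2_def using DERIV_cdivide[OF J_deriv_s[of s 1 2 pi], of "2 * pi"]
  by (simp add: eval_nat_numeral)

text \<open>The estimate behind the existence time: \<open>1 / (1 - y) \<ge> 1 + y\<close> for \<open>y = s \<phi>\<close>, and \<open>\<phi>\<close> has
  zero mean.\<close>
lemma K_ge_1:
  assumes "s \<in> S"
  shows "1 \<le> K s"
proof -
  have i: "integrable torus_measure (\<lambda>y. 1 / (1 - s * \<phi> y))" "integrable torus_measure \<phi>"
    using L2_integrable[OF L2_continuous[OF frac_cont_space[OF assms, of 0 1]]]
      L2_integrable[OF L2_continuous[OF \<phi>_cont]] by simp_all
  have "torus_integral (\<lambda>y. 1 + s * \<phi> y) = torus_integral (\<lambda>y. 1) + s * torus_integral \<phi>"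
    using i unfolding torus_integral_eq by simp
  then have "2 * pi = torus_integral (\<lambda>y. 1 + s * \<phi> y)"
    by (simp add: mean_zero torus_integral_const)
  also have "\<dots> \<le> torus_integral (\<lambda>y. 1 / (1 - s * \<phi> y))"
    unfolding torus_integral_eq
  proof (rule integral_mono)
    fix y
    have "0 < 1 - s * \<phi> y" by (rule denom_pos[OF assms])
    moreover have "(1 + s * \<phi> y) * (1 - s * \<phi> y) \<le> 1"
      using zero_le_square[of "s * \<phi> y"] by (simp add: algebra_simps)
    ultimately show "1 + s * \<phi> y \<le> 1 / (1 - s * \<phi> y)" by (simp add: pos_le_divide_eq)
  qed (use i in auto)
  also have "\<dots> = J 0 1 s pi" using torus_integral_frac[of 0 s 1] by simp
  finally show ?thesis by (simp add: K_def field_simps)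
qed

lemma K_pos: "s \<in> S \<Longrightarrow> 0 < K s" using K_ge_1[of s] by simp

text \<open>In terms of the original time, \<open>A\<close> is \<open>ds/dt\<close>, \<open>B\<close> is \<open>g\<close>, and \<open>B1\<close> is \<open>dg/ds\<close>.\<close>
definition A :: "real \<Rightarrow> real" where "A s = 1 / K s"
definition B :: "real \<Rightarrow> real" where "B s = K1 s / (K s)\<^sup>2"
definition B1 :: "real \<Rightarrow> real" where "B1 s = K2 s / (K s)\<^sup>2 - 2 * (K1 s)\<^sup>2 / (K s) ^ 3"

lemma A_pos: "s \<in> S \<Longrightarrow> 0 < A s" using K_pos by (simp add: A_def)
lemma A_le_1: "s \<in> S \<Longrightarrow> A s \<le> 1" using K_ge_1[of s] by (simp add: A_def)

lemma A_deriv: "s \<in> S \<Longrightarrow> (A has_real_derivative - B s) (at s)"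
  using DERIV_divide[OF DERIV_const[of 1] K_deriv[of s]] K_pos[of s]
  unfolding A_def[abs_def] B_def by (simp add: power2_eq_square)

lemma B_deriv:
  assumes "s \<in> S" shows "(B has_real_derivative B1 s) (at s)"
proof -
  have "(B has_real_derivative (K2 s * (K s)\<^sup>2 - K1 s * (2 * K s * K1 s)) / ((K s)\<^sup>2 * (K s)\<^sup>2)) (at s)"
  proof -
    have "((\<lambda>s. (K s)\<^sup>2) has_real_derivative 2 * K s * K1 s) (at s)"
      using DERIV_power[OF K_deriv[OF assms], of 2] by (simp add: mult_ac)
    from DERIV_divide[OF K1_deriv[OF assms] this] show ?thesis
      using K_pos[OF assms] unfolding B_def[abs_def] by simp
  qed
  moreover have "(K2 s * (K s)\<^sup>2 - K1 s * (2 * K s * K1 s)) / ((K s)\<^sup>2 * (K s)\<^sup>2) = B1 s"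
    using K_pos[OF assms] by (simp add: B1_def field_simps eval_nat_numeral)
  ultimately show ?thesis by simp
qed

lemma B_zero: "B 0 = 0"
  using torus_integral_frac[of 1 0 2] mean_zero by (simp add: B_def K1_def)

lemma differentiable_continuous_on_S:
  assumes "\<And>s. s \<in> S \<Longrightarrow> (h has_real_derivative h' s) (at s)"
  shows "continuous_on S h"
  by (meson assms DERIV_isCont continuous_at_imp_continuous_on)

lemma K_cont: "continuous_on S K" by (rule differentiable_continuous_on_S[OF K_deriv])
lemma A_cont: "continuous_on S A" by (rule differentiable_continuous_on_S[OF A_deriv])
lemma B_cont: "continuous_on S B" by (rule differentiable_continuous_on_S[OF B_deriv])

lemma B1_cont: "continuous_on S B1"
proof -
  have "continuous_on S (\<lambda>s. J 2 3 s pi)"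
    by (rule differentiable_continuous_on_S[OF J_deriv_s])
  then have "continuous_on S K2" unfolding K2_def[abs_def] by (intro continuous_intros) simp_all
  moreover have "continuous_on S K1" by (rule differentiable_continuous_on_S[OF K1_deriv])
  moreover have "\<forall>s\<in>S. K s \<noteq> 0" using K_pos by fastforce
  ultimately show ?thesis
    using K_cont unfolding B1_def[abs_def] by (intro continuous_intros) auto
qed

text \<open>\<open>\<rho>\<close> is the Jacobian of the flow map \<open>\<gamma>\<close>, which fixes \<open>-\<pi>\<close>, and \<open>q\<close> is the derivative of \<open>\<gamma>\<close>
  in \<open>s\<close>.\<close>
definition \<rho> :: "real \<Rightarrow> real \<Rightarrow> real" where "\<rho> s a = A s / (1 - s * \<phi> a)"
definition \<gamma> :: "real \<Rightarrow> real \<Rightarrow> real" where "\<gamma> s a = - pi + A s * J 0 1 s a"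
definition q :: "real \<Rightarrow> real \<Rightarrow> real" where "q s a = A s * J 1 2 s a - B s * J 0 1 s a"

lemma \<rho>_pos: "s \<in> S \<Longrightarrow> 0 < \<rho> s a"
  unfolding \<rho>_def using A_pos denom_pos by simp

lemma \<rho>_cont: "continuous_on (S \<times> UNIV) (\<lambda>(s, a). \<rho> s a)"
proof -
  have "continuous_on (S \<times> UNIV) (\<lambda>p. A (fst p) * (case p of (s, a) \<Rightarrow> \<phi> a ^ 0 / (1 - s * \<phi> a) ^ 1))"
    by (intro continuous_on_mult frac_cont continuous_on_compose2[OF A_cont] continuous_intros) auto
  then show ?thesis by (simp add: \<rho>_def split_beta)
qed

lemma \<gamma>_deriv_a: "s \<in> S \<Longrightarrow> (\<gamma> s has_real_derivative \<rho> s a) (at a)"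
  unfolding \<gamma>_def \<rho>_def 
  using DERIV_add[OF DERIV_const[of "-pi"] DERIV_cmult[OF J_deriv_a[of s 0 1 a], of "A s"]] by simp

lemma \<gamma>_deriv_s: "s \<in> S \<Longrightarrow> ((\<lambda>s. \<gamma> s a) has_real_derivative q s a) (at s)"
  unfolding \<gamma>_def q_def
  using DERIV_add[OF DERIV_const[of "-pi"] DERIV_mult[OF A_deriv[of s] J_deriv_s[of s 0 1 a]]]
  by (simp add: numeral_2_eq_2 algebra_simps)

lemma J_left [simp]: "J j k s (-pi) = 0" by (simp add: J_def)

lemma \<gamma>_left: "\<gamma> s (-pi) = -pi" by (simp add: \<gamma>_def)

text \<open>The normalisation \<open>A = 1 / K\<close> is chosen to make this true: the flow preserves the period.\<close>
lemma \<gamma>_right: "s \<in> S \<Longrightarrow> \<gamma> s pi = pi"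
  using K_pos[of s] by (simp add: \<gamma>_def A_def K_def field_simps)

lemma \<gamma>_strict_mono: "s \<in> S \<Longrightarrow> strict_mono (\<gamma> s)"
  by (rule strict_monoI, rule DERIV_pos_imp_increasing) (auto intro: \<gamma>_deriv_a \<rho>_pos)

lemma \<gamma>_shift:
  assumes "s \<in> S" shows "\<gamma> s (a + 2 * pi) = \<gamma> s a + 2 * pi"
proof -
  have "((\<lambda>a. \<gamma> s (a + 2 * pi) - \<gamma> s a) has_real_derivative 0) (at a)" for a
    using \<phi>_periodic
    by (auto intro!: derivative_eq_intros DERIV_chain2[OF \<gamma>_deriv_a] \<gamma>_deriv_a assms simp: periodic_2pi_def \<rho>_def)
  then have "\<gamma> s (a + 2 * pi) - \<gamma> s a = \<gamma> s (-pi + 2 * pi) - \<gamma> s (-pi)"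
    using DERIV_isconst_all[of "\<lambda>a. \<gamma> s (a + 2 * pi) - \<gamma> s a"] by blast
  then show ?thesis using \<gamma>_right[OF assms] \<gamma>_left by simp
qed

text \<open>The Jacobian is bounded below by some \<open>c > 0\<close>, so \<open>\<gamma> s\<close> is unbounded in both directions.\<close>
lemma \<gamma>_surj:
  assumes "s \<in> S" shows "\<exists>a. \<gamma> s a = x"
proof -
  define D where "D = 1 + \<bar>s\<bar> * (\<bar>m\<bar> + \<bar>M\<bar>)"
  have "D > 0" unfolding D_def by (intro add_pos_nonneg) auto
  have D: "1 - s * \<phi> a \<le> D" for a
  proof -
    have "\<bar>\<phi> a\<bar> \<le> \<bar>m\<bar> + \<bar>M\<bar>" using lower[of a] upper[of a] by linarith
    then have "\<bar>s * \<phi> a\<bar> \<le> \<bar>s\<bar> * (\<bar>m\<bar> + \<bar>M\<bar>)" unfolding abs_mult by (rule mult_left_mono) simp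
    then show ?thesis unfolding D_def by linarith
  qed
  define c where "c = A s / D"
  have "c > 0" using A_pos[OF assms] \<open>D > 0\<close> by (simp add: c_def)
  have c: "c \<le> \<rho> s a" for a
    unfolding c_def \<rho>_def using A_pos[OF assms] denom_pos[OF assms, of a] D[of a]
    by (intro divide_left_mono mult_pos_pos) (auto intro: \<open>D > 0\<close>)
  have mono: "\<gamma> s a - c * a \<le> \<gamma> s b - c * b" if "a \<le> b" for a b
  proof (rule DERIV_nonneg_imp_nondecreasing[OF that])
    fix y
    show "\<exists>d. ((\<lambda>a. \<gamma> s a - c * a) has_real_derivative d) (at y) \<and> 0 \<le> d"
      using c[of y] by (intro exI[of _ "\<rho> s y - c"]) (auto intro!: derivative_eq_intros \<gamma>_deriv_a assms)
  qed
  define r where "r = \<bar>x + pi\<bar> / c"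
  have "r \<ge> 0" "c * r = \<bar>x + pi\<bar>" using \<open>c > 0\<close> by (auto simp: r_def)
  have "\<gamma> s (-pi - r) \<le> x"
    using mono[of "-pi - r" "-pi"] \<open>r \<ge> 0\<close> \<open>c * r = _\<close> \<gamma>_left[of s] by (simp add: algebra_simps)
  moreover have "x \<le> \<gamma> s (-pi + r)"
    using mono[of "-pi" "-pi + r"] \<open>r \<ge> 0\<close> \<open>c * r = _\<close> \<gamma>_left[of s] by (simp add: algebra_simps)
  moreover have "continuous_on {-pi - r..-pi + r} (\<gamma> s)"
    using \<gamma>_deriv_a[OF assms] by (meson DERIV_isCont continuous_at_imp_continuous_on)
  ultimately show ?thesis
    using IVT'[of "\<gamma> s" "-pi - r" x "-pi + r"] \<open>r \<ge> 0\<close> by auto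
qed

definition X :: "real \<Rightarrow> real \<Rightarrow> real" where "X s x = (THE a. \<gamma> s a = x)"

lemma X_\<gamma>: "s \<in> S \<Longrightarrow> X s (\<gamma> s a) = a"
  unfolding X_def using strict_mono_eq[OF \<gamma>_strict_mono] by auto

lemma \<gamma>_X: "s \<in> S \<Longrightarrow> \<gamma> s (X s x) = x"
  using \<gamma>_surj[of s x] X_\<gamma>[of s] by auto

lemma X_left: "s \<in> S \<Longrightarrow> X s (-pi) = -pi" using X_\<gamma>[of s "-pi"] \<gamma>_left by simp
lemma X_right: "s \<in> S \<Longrightarrow> X s pi = pi" using X_\<gamma>[of s pi] \<gamma>_right by simp

lemma X_shift: "s \<in> S \<Longrightarrow> X s (x + 2 * pi) = X s x + 2 * pi"
  using X_\<gamma>[of s "X s x + 2 * pi"] \<gamma>_shift[of s "X s x"] \<gamma>_X[of s x] by simp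

lemma \<gamma>_deriv:
  assumes "s \<in> S"
  shows "((\<lambda>p. \<gamma> (fst p) (snd p)) has_derivative (\<lambda>h. q s a * fst h + \<rho> s a * snd h)) (at (s, a))"
proof -
  have "((\<lambda>(s, a). \<gamma> s a) has_derivative (\<lambda>(ts, ta). q s a * ts + blinfun_mult_right (\<rho> s a) ta)) (at (s, a) within S \<times> UNIV)"
  proof (rule has_derivative_partialsI[where fy = "\<lambda>s a. blinfun_mult_right (\<rho> s a)"])
    show "((\<lambda>s. \<gamma> s a) has_derivative (*) (q s a)) (at s within S)"
      using \<gamma>_deriv_s[OF assms, of a] by (simp add: has_field_derivative_def has_derivative_at_withinI)
    show "((\<lambda>a. \<gamma> s a) has_derivative blinfun_apply (blinfun_mult_right (\<rho> s a))) (at a within UNIV)"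
      if "s \<in> S" for s a
      using \<gamma>_deriv_a[OF that, of a] by (simp add: has_field_derivative_def)
    have "continuous_on (S \<times> UNIV) (\<lambda>p. blinfun_mult_right (case p of (s, a) \<Rightarrow> \<rho> s a))"
      by (rule bounded_linear.continuous_on[OF bounded_linear_blinfun_mult_right \<rho>_cont])
    then show "continuous (at (s, a) within S \<times> UNIV) (\<lambda>(s, a). blinfun_mult_right (\<rho> s a))"
      using assms by (auto simp: continuous_on_eq_continuous_within split_beta')
  qed auto
  then have "((\<lambda>(s, a). \<gamma> s a) has_derivative (\<lambda>(ts, ta). q s a * ts + \<rho> s a * ta)) (at (s, a) within S \<times> UNIV)"
    by simp
  moreover have "at (s, a) within S \<times> UNIV = at (s, a)"
    using assms by (intro at_within_open open_Times open_S open_UNIV) auto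
  ultimately show ?thesis by (simp add: split_beta')
qed

text \<open>The inverse function theorem for \<open>(s, a) \<mapsto> (s, \<gamma> s a)\<close>; the first component is carried along
  in order to obtain joint differentiability of \<open>X\<close> in \<open>s\<close> and \<open>x\<close>.\<close>
lemma X_deriv:
  assumes "s \<in> S"
  shows "((\<lambda>p. X (fst p) (snd p)) has_derivative
    (\<lambda>h. (snd h - q s (X s x) * fst h) / \<rho> s (X s x))) (at (s, x))"
proof -
  let ?a = "X s x"
  have "((\<lambda>p. (fst p, X (fst p) (snd p))) has_derivative
     (\<lambda>h. (fst h, (snd h - q s ?a * fst h) / \<rho> s ?a))) (at (s, x))"
  proof (rule has_derivative_inverse_strong_x[where S = "S \<times> UNIV"
        and f = "\<lambda>p. (fst p, \<gamma> (fst p) (snd p))" and f' = "\<lambda>h. (fst h, q s ?a * fst h + \<rho> s ?a * snd h)"])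
    show "open (S \<times> (UNIV :: real set))" by (intro open_Times open_S open_UNIV)
    show "(fst (s, x), X (fst (s, x)) (snd (s, x))) \<in> S \<times> UNIV" using assms by simp
    have der: "((\<lambda>p. (fst p, \<gamma> (fst p) (snd p))) has_derivative (\<lambda>h. (fst h, q s a * fst h + \<rho> s a * snd h))) (at (s, a))"
      if "s \<in> S" for s a
      by (intro has_derivative_Pair \<gamma>_deriv that) (auto intro!: derivative_eq_intros)
    show "continuous_on (S \<times> UNIV) (\<lambda>p. (fst p, \<gamma> (fst p) (snd p)))"
      by (rule continuous_at_imp_continuous_on) (auto intro!: has_derivative_continuous[OF der])
    show "((\<lambda>p. (fst p, \<gamma> (fst p) (snd p))) has_derivative (\<lambda>h. (fst h, q s ?a * fst h + \<rho> s ?a * snd h)))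
       (at (fst (s, x), X (fst (s, x)) (snd (s, x))))"
      using der[OF assms] by simp
    show "(\<lambda>h. (fst h, q s ?a * fst h + \<rho> s ?a * snd h)) \<circ> (\<lambda>h. (fst h, (snd h - q s ?a * fst h) / \<rho> s ?a)) = id"
      using \<rho>_pos[OF assms, of ?a] by (auto simp: fun_eq_iff)
  qed (use assms in \<open>auto simp: X_\<gamma> \<gamma>_X\<close>)
  from has_derivative_snd[OF this] show ?thesis by simp
qed

lemma X_cont: "continuous_on (S \<times> UNIV) (\<lambda>p. X (fst p) (snd p))"
  by (rule continuous_at_imp_continuous_on) (auto intro!: has_derivative_continuous[OF X_deriv])

lemma X_cont_space: "s \<in> S \<Longrightarrow> continuous_on UNIV (X s)"
  by (rule continuous_on_compose2[OF X_cont, where f="\<lambda>y. (s, y)", simplified])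
     (auto intro!: continuous_intros)

lemma X_deriv_x:
  assumes "s \<in> S"
  shows "(X s has_real_derivative 1 / \<rho> s (X s x)) (at x)"
proof -
  have "((\<lambda>y. (s, y)) has_derivative (\<lambda>h. (0, h))) (at x)"
    by (auto intro!: derivative_eq_intros)
  from has_derivative_compose[OF this X_deriv[OF assms]]
  have "(X s has_derivative (\<lambda>h. h / \<rho> s (X s x))) (at x)" by simp
  then show ?thesis
    unfolding has_field_derivative_def by (rule has_derivative_eq_rhs) (auto simp: fun_eq_iff)
qed

lemma X_deriv_s:
  assumes "s \<in> S"
  shows "((\<lambda>s. X s x) has_real_derivative - q s (X s x) / \<rho> s (X s x)) (at s)"
proof -
  have "((\<lambda>s. (s, x)) has_derivative (\<lambda>h. (h, 0))) (at s)"
    by (auto intro!: derivative_eq_intros)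
  from has_derivative_compose[OF this X_deriv[OF assms]]
  have "((\<lambda>s. X s x) has_derivative (\<lambda>h. - (q s (X s x) * h) / \<rho> s (X s x))) (at s)" by simp
  then show ?thesis
    unfolding has_field_derivative_def by (rule has_derivative_eq_rhs) (auto simp: fun_eq_iff)
qed

section \<open>The solution as a function of the new time\<close>

text \<open>\<open>u\<close> is the solution along the flow; \<open>U\<close>, \<open>Ux\<close>, \<open>Uxx\<close> are \<open>f\<^sub>x\<close> and its two derivatives in
  the space variable; \<open>F\<close> is \<open>f\<close>, that is, the velocity \<open>d\<gamma>/dt = A d\<gamma>/ds\<close> of the flow.\<close>
definition u :: "real \<Rightarrow> real \<Rightarrow> real" where "u s a = A s * (\<phi> a / (1 - s * \<phi> a)) - B s"
definition U :: "real \<Rightarrow> real \<Rightarrow> real" where "U s x = u s (X s x)"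
definition Ux :: "real \<Rightarrow> real \<Rightarrow> real" where "Ux s x = \<phi>' (X s x) / (1 - s * \<phi> (X s x))"
definition Uxx :: "real \<Rightarrow> real \<Rightarrow> real" where
  "Uxx s x = K s * (w (X s x) + s * (\<phi>' (X s x))\<^sup>2 / (1 - s * \<phi> (X s x)))"
definition F :: "real \<Rightarrow> real \<Rightarrow> real" where "F s x = A s * q s (X s x)"

lemma u_deriv_a:
  assumes "s \<in> S"
  shows "(u s has_real_derivative A s * (\<phi>' a / (1 - s * \<phi> a)\<^sup>2)) (at a)"
proof -
  have d: "((\<lambda>a. 1 - s * \<phi> a) has_real_derivative 0 - s * \<phi>' a) (at a)"
    by (intro DERIV_diff DERIV_const DERIV_cmult \<phi>_deriv)
  have "((\<lambda>a. \<phi> a / (1 - s * \<phi> a)) has_real_derivative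
     (\<phi>' a * (1 - s * \<phi> a) - \<phi> a * (0 - s * \<phi>' a)) / ((1 - s * \<phi> a) * (1 - s * \<phi> a))) (at a)"
    by (rule DERIV_divide[OF \<phi>_deriv d denom_neq[OF assms]])
  also have "(\<phi>' a * (1 - s * \<phi> a) - \<phi> a * (0 - s * \<phi>' a)) / ((1 - s * \<phi> a) * (1 - s * \<phi> a))
     = \<phi>' a / (1 - s * \<phi> a)\<^sup>2"
    by (simp add: power2_eq_square algebra_simps)
  finally show ?thesis
    unfolding u_def using DERIV_diff[OF DERIV_cmult[of _ _ a UNIV "A s"] DERIV_const[of "B s"]] by fastforce
qed

lemma U_deriv_x:
  assumes "s \<in> S"
  shows "(U s has_real_derivative Ux s x) (at x)"
proof -
  have "(U s has_real_derivative A s * (\<phi>' (X s x) / (1 - s * \<phi> (X s x))\<^sup>2) * (1 / \<rho> s (X s x))) (at x)"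
    unfolding U_def by (rule DERIV_chain2[OF u_deriv_a[OF assms] X_deriv_x[OF assms]])
  also have "A s * (\<phi>' (X s x) / (1 - s * \<phi> (X s x))\<^sup>2) * (1 / \<rho> s (X s x)) = Ux s x"
    unfolding Ux_def \<rho>_def using A_pos[OF assms] denom_neq[OF assms, of "X s x"]
    by (simp add: power2_eq_square)
  finally show ?thesis .
qed

lemma X_chain_cont:
  assumes "continuous_on (S \<times> UNIV) (\<lambda>p. h (fst p) (snd p))"
  shows "continuous_on (S \<times> UNIV) (\<lambda>p. h (fst p) (X (fst p) (snd p)))"
  by (rule continuous_on_compose2[OF assms, where f = "\<lambda>p. (fst p, X (fst p) (snd p))", simplified])
     (auto intro!: continuous_intros X_cont)

lemma \<phi>_snd_cont: "continuous_on T (\<lambda>p::real \<times> real. \<phi> (snd p))"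
  by (rule continuous_on_compose2[OF \<phi>_cont[of UNIV]]) (auto intro!: continuous_intros)

lemma \<phi>'_snd_cont: "continuous_on T (\<lambda>p::real \<times> real. \<phi>' (snd p))"
  by (rule continuous_on_compose2[OF \<phi>'_cont]) (auto intro!: continuous_intros)

lemma fst_S_cont: "continuous_on S h \<Longrightarrow> continuous_on (S \<times> UNIV) (\<lambda>p. h (fst p))"
  by (rule continuous_on_compose2) (auto intro!: continuous_intros)

lemma U_cont: "continuous_on (S \<times> UNIV) (\<lambda>p. U (fst p) (snd p))"
  unfolding U_def
  by (rule X_chain_cont)
     (auto simp: u_def prod_neq_1 intro!: continuous_intros \<phi>_snd_cont fst_S_cont A_cont B_cont)

lemma Ux_cont: "continuous_on (S \<times> UNIV) (\<lambda>p. Ux (fst p) (snd p))"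
  unfolding Ux_def
  by (rule X_chain_cont)
     (auto simp: prod_neq_1 intro!: continuous_intros \<phi>_snd_cont \<phi>'_snd_cont)

lemma continuous_on_slice:
  assumes "continuous_on (S \<times> UNIV) (\<lambda>p. h (fst p) (snd p))" "s \<in> S"
  shows "continuous_on UNIV (h s)"
  by (rule continuous_on_compose2[OF assms(1), where f="\<lambda>y. (s, y)", simplified])
     (use assms(2) in \<open>auto intro!: continuous_intros\<close>)

lemmas U_cont_space = continuous_on_slice[OF U_cont]
lemmas Ux_cont_space = continuous_on_slice[OF Ux_cont]

lemma U_periodic: "s \<in> S \<Longrightarrow> periodic_2pi (U s)"
  using \<phi>_periodic by (simp add: periodic_2pi_def U_def u_def X_shift)

lemma q_deriv_a:
  assumes "s \<in> S"
  shows "(q s has_real_derivative u s a / (1 - s * \<phi> a)) (at a)"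
proof -
  have "(q s has_real_derivative A s * (\<phi> a ^ 1 / (1 - s * \<phi> a) ^ 2) - B s * (\<phi> a ^ 0 / (1 - s * \<phi> a) ^ 1)) (at a)"
    unfolding q_def by (intro DERIV_diff DERIV_cmult J_deriv_a assms)
  also have "A s * (\<phi> a ^ 1 / (1 - s * \<phi> a) ^ 2) - B s * (\<phi> a ^ 0 / (1 - s * \<phi> a) ^ 1) = u s a / (1 - s * \<phi> a)"
    using denom_neq[OF assms, of a] by (simp add: u_def power2_eq_square diff_divide_distrib)
  finally show ?thesis .
qed

lemma F_deriv:
  assumes "s \<in> S"
  shows "(F s has_real_derivative U s x) (at x)"
proof -
  have "(F s has_real_derivative A s * (u s (X s x) / (1 - s * \<phi> (X s x)) * (1 / \<rho> s (X s x)))) (at x)"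
    unfolding F_def by (intro DERIV_cmult DERIV_chain2[OF q_deriv_a[OF assms] X_deriv_x[OF assms]])
  also have "A s * (u s (X s x) / (1 - s * \<phi> (X s x)) * (1 / \<rho> s (X s x))) = U s x"
    using A_pos[OF assms] denom_neq[OF assms, of "X s x"] by (simp add: U_def \<rho>_def)
  finally show ?thesis .
qed

lemma F_eq_integral:
  assumes "s \<in> S"
  shows "(LBINT y=ereal (-pi)..ereal x. U s y) = F s x"
  using integral_of_deriv[OF U_cont_space F_deriv, OF assms assms, of "-pi" x]
  by (simp add: F_def q_def X_left[OF assms])

lemma U_deriv_s:
  fixes x
  assumes "s \<in> S"
  defines "r \<equiv> \<phi> (X s x) / (1 - s * \<phi> (X s x))"
  shows "((\<lambda>s. U s x) has_real_derivative
    - B s * r + A s * (r\<^sup>2 - \<phi>' (X s x) / (1 - s * \<phi> (X s x))\<^sup>2 * (q s (X s x) / \<rho> s (X s x))) - B1 s) (at s)"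
proof -
  define p where "p s = \<phi> (X s x)" for s
  define p' where "p' = \<phi>' (X s x) * (- q s (X s x) / \<rho> s (X s x))"
  define d where "d = 1 - s * p s"
  have d: "d \<noteq> 0" unfolding d_def p_def by (rule denom_neq[OF assms(1)])
  have p: "(p has_real_derivative p') (at s)"
    unfolding p_def p'_def by (rule DERIV_chain2[OF \<phi>_deriv X_deriv_s[OF assms(1)]])
  have "((\<lambda>s. 1 - s * p s) has_real_derivative 0 - (1 * p s + p' * s)) (at s)"
    by (intro DERIV_diff DERIV_const DERIV_mult DERIV_ident p)
  from DERIV_divide[OF p this] d
  have "((\<lambda>s. p s / (1 - s * p s)) has_real_derivative (p' * d - p s * (0 - (1 * p s + p' * s))) / (d * d)) (at s)"
    unfolding d_def by blast
  also have "(p' * d - p s * (0 - (1 * p s + p' * s))) / (d * d) = (p s / d)\<^sup>2 + p' / d\<^sup>2"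
    unfolding d_def by (simp add: power_divide power2_eq_square algebra_simps add_divide_distrib diff_divide_distrib)
  finally have "((\<lambda>s. A s * (p s / (1 - s * p s)) - B s) has_real_derivative
      - B s * (p s / (1 - s * p s)) + ((p s / d)\<^sup>2 + p' / d\<^sup>2) * A s - B1 s) (at s)"
    by (intro DERIV_diff DERIV_mult A_deriv B_deriv assms(1))
  then show ?thesis
    unfolding U_def u_def r_def p_def p'_def d_def by (simp add: algebra_simps)
qed

text \<open>The factor \<open>K\<close> is \<open>dt/ds\<close>, and the other factor is the right-hand side of the equation with
  \<open>g = B\<close> and \<open>dg/dt = A B1\<close>.\<close>
lemma U_evolution:
  assumes "s \<in> S"
  shows "((\<lambda>s. U s x) has_real_derivative
    K s * (- (A s * B1 s) - F s x * Ux s x + (U s x)\<^sup>2 + B s * U s x)) (at s)"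
proof -
  define r where "r = \<phi> (X s x) / (1 - s * \<phi> (X s x))"
  define d where "d = 1 - s * \<phi> (X s x)"
  have d: "d \<noteq> 0" unfolding d_def by (rule denom_neq[OF assms])
  have KA: "K s * A s = 1" "A s * K s = 1" using K_pos[OF assms] by (auto simp: A_def)
  have U: "U s x = A s * r - B s" by (simp add: U_def u_def r_def)
  have t: "A s * (\<phi>' (X s x) / d\<^sup>2 * (q s (X s x) / \<rho> s (X s x))) = q s (X s x) * Ux s x"
    using d A_pos[OF assms] by (simp add: Ux_def \<rho>_def power2_eq_square d_def[symmetric])
  have "K s * (- (A s * B1 s) - F s x * Ux s x + (U s x)\<^sup>2 + B s * U s x)
      = (K s * A s) * (- B1 s - q s (X s x) * Ux s x + A s * r\<^sup>2 - B s * r)"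
    unfolding U F_def by (simp add: power2_eq_square algebra_simps)
  also have "\<dots> = - B s * r + A s * (r\<^sup>2 - \<phi>' (X s x) / d\<^sup>2 * (q s (X s x) / \<rho> s (X s x))) - B1 s"
    unfolding KA right_diff_distrib t by simp
  finally show ?thesis
    using U_deriv_s[OF assms, of x] unfolding r_def d_def by simp
qed

text \<open>Change of variables for functions that are merely integrable, as required for \<open>w\<close>.\<close>
lemma X_substitution:
  assumes s: "s \<in> S" and k: "integrable torus_measure k"
  shows "integrable torus_measure (\<lambda>x. k (X s x) / \<rho> s (X s x))"
    and "torus_integral (\<lambda>x. k (X s x) / \<rho> s (X s x)) = torus_integral k"
proof -
  have ki: "set_integrable lborel {X s (-pi)..X s pi} k"
    using set_integrable_closed_torus[OF k] by (simp add: X_left X_right s)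
  have \<rho>X: "continuous_on UNIV (\<lambda>x. \<rho> s (X s x))"
    by (rule continuous_on_compose2[OF continuous_on_slice[of \<rho>, OF _ s] X_cont_space[OF s]])
       (use \<rho>_cont in \<open>auto simp: split_beta\<close>)
  have c: "continuous_on {-pi..pi} (\<lambda>x. 1 / \<rho> s (X s x))"
    using \<rho>_pos[OF s] by (intro continuous_intros continuous_on_subset[OF \<rho>X]) (auto simp: less_imp_neq[symmetric])
  have nn: "0 \<le> 1 / \<rho> s (X s x)" for x using \<rho>_pos[OF s, of "X s x"] by simp
  note sub = integral_substitution[OF ki X_deriv_x[OF s] c nn]
  have i: "set_integrable lborel {-pi..pi} (\<lambda>x. k (X s x) * (1 / \<rho> s (X s x)))"
    by (rule sub(1)) auto
  have "set_integrable lborel {-pi..<pi} (\<lambda>x. k (X s x) * (1 / \<rho> s (X s x)))"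
    by (rule set_integrable_subset[OF i]) auto
  then show "integrable torus_measure (\<lambda>x. k (X s x) / \<rho> s (X s x))"
    by (simp add: integrable_torus_iff)
  have cl: "torus_integral h = (LBINT x. h x * indicator {-pi..pi} x)" for h
    unfolding torus_integral_interval
    by (subst interval_integral_Icc) (auto simp: set_lebesgue_integral_def mult.commute)
  have "(LBINT x. k x * indicator {X s (-pi)..X s pi} x) = (LBINT x. k (X s x) * (1 / \<rho> s (X s x)) * indicator {-pi..pi} x)"
    by (rule sub(2)) auto
  then show "torus_integral (\<lambda>x. k (X s x) / \<rho> s (X s x)) = torus_integral k"
    by (simp add: cl X_left X_right s)
qed

lemma X_composition:
  assumes s: "s \<in> S" and h: "integrable torus_measure (\<lambda>a. h a * \<rho> s a)"
  shows "integrable torus_measure (\<lambda>x. h (X s x))"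
    and "torus_integral (\<lambda>x. h (X s x)) = torus_integral (\<lambda>a. h a * \<rho> s a)"
  using X_substitution[OF s h] \<rho>_pos[OF s] by (simp_all add: less_imp_neq[symmetric])

lemma continuous_integrable:
  fixes h :: "real \<Rightarrow> real"
  shows "continuous_on UNIV h \<Longrightarrow> integrable torus_measure h"
  by (rule L2_integrable[OF L2_continuous])

lemma frac_integrable: "s \<in> S \<Longrightarrow> integrable torus_measure (\<lambda>y. \<phi> y ^ j / (1 - s * \<phi> y) ^ k)"
  by (intro continuous_integrable frac_cont_space)

text \<open>The nonlocal term of the equation: \<open>\<parallel>f\<^sub>x\<parallel>\<^sup>2 = \<pi> dg/dt\<close>. After the change of variables
  every term of the expanded square is a multiple of one of \<open>K\<close>, \<open>K1\<close>, \<open>K2\<close>.\<close>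
lemma energy:
  assumes s: "s \<in> S"
  shows "torus_integral (\<lambda>x. (U s x)\<^sup>2) = pi * (A s * B1 s)"
proof -
  let ?f = "\<lambda>j k a. \<phi> a ^ j / (1 - s * \<phi> a) ^ k"
  have eq: "(u s a)\<^sup>2 * \<rho> s a = A s ^ 3 * ?f 2 3 a - 2 * (A s)\<^sup>2 * B s * ?f 1 2 a + A s * (B s)\<^sup>2 * ?f 0 1 a" for a
  proof -
    have "(A s * (p / d) - B s)\<^sup>2 * (A s / d) = A s ^ 3 * (p ^ 2 / d ^ 3) - 2 * (A s)\<^sup>2 * B s * (p ^ 1 / d ^ 2)
        + A s * (B s)\<^sup>2 * (p ^ 0 / d ^ 1)" if "d \<noteq> 0" for p d
      using that by (simp add: field_simps eval_nat_numeral)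
    from this[OF denom_neq[OF s]] show ?thesis by (simp only: u_def \<rho>_def)
  qed
  have i: "integrable torus_measure (\<lambda>a. (u s a)\<^sup>2 * \<rho> s a)"
    unfolding eq by (intro Bochner_Integration.integrable_add Bochner_Integration.integrable_diff integrable_mult_right frac_integrable s)
  have "torus_integral (\<lambda>x. (U s x)\<^sup>2) = torus_integral (\<lambda>a. (u s a)\<^sup>2 * \<rho> s a)"
    unfolding U_def using X_composition(2)[OF s i] .
  also have "\<dots> = A s ^ 3 * J 2 3 s pi - 2 * (A s)\<^sup>2 * B s * J 1 2 s pi + A s * (B s)\<^sup>2 * J 0 1 s pi"
  proof -
    have lin: "torus_integral (\<lambda>a. x * f a - y * g a + z * h a)
        = x * torus_integral f - y * torus_integral g + z * torus_integral h"
      if "integrable torus_measure f" "integrable torus_measure g" "integrable torus_measure h"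
      for x y z :: real and f g h :: "real \<Rightarrow> real"
      using that by (simp add: torus_integral_eq)
    show ?thesis
      unfolding eq torus_integral_frac[symmetric] by (intro lin frac_integrable s)
  qed
  also have "J 2 3 s pi = pi * K2 s" by (simp add: K2_def)
  also have "J 1 2 s pi = 2 * pi * K1 s" by (simp add: K1_def)
  also have "J 0 1 s pi = 2 * pi * K s" by (simp add: K_def)
  also have "A s ^ 3 * (pi * K2 s) - 2 * (A s)\<^sup>2 * B s * (2 * pi * K1 s) + A s * (B s)\<^sup>2 * (2 * pi * K s) = pi * (A s * B1 s)"
    unfolding A_def B_def B1_def using K_pos[OF s] by (simp add: field_simps eval_nat_numeral)
  finally show ?thesis .
qed

section \<open>Regularity in space and continuity in the new time\<close>

text \<open>An upper bound for the Jacobian \<open>\<rho> s\<close>, and so for the squared \<open>L\<^sup>2\<close> operator norm of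
  composition with \<open>X s\<close>.\<close>
definition c :: "real \<Rightarrow> real" where "c s = 1 / min (1 - s * m) (1 - s * M)"

lemma \<rho>_le: "s \<in> S \<Longrightarrow> \<rho> s a \<le> c s"
  unfolding \<rho>_def c_def using A_le_1[of s] denom_ge[of s a] A_pos[of s]
  by (intro frac_le) (auto simp: S_def)

lemma c_pos: "s \<in> S \<Longrightarrow> 0 < c s" by (simp add: c_def S_def)

lemma c_cont: "continuous_on S c"
  unfolding c_def[abs_def] by (intro continuous_intros) (auto simp: S_def min_def)

lemma X_comp_L2:
  assumes s: "s \<in> S" and v: "v \<in> L2_torus"
  shows "(\<lambda>x. v (X s x)) \<in> L2_torus"
    and "torus_integral (\<lambda>x. (v (X s x))\<^sup>2) \<le> c s * torus_integral (\<lambda>x. (v x)\<^sup>2)"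
proof -
  have [measurable]: "v \<in> borel_measurable borel" using v by (simp add: L2_torus_iff)
  have [measurable]: "X s \<in> borel_measurable borel"
    by (rule borel_measurable_continuous_onI[OF X_cont_space[OF s]])
  have [measurable]: "\<rho> s \<in> borel_measurable borel"
    by (rule borel_measurable_continuous_onI, rule continuous_on_slice[of \<rho>, OF _ s]) (use \<rho>_cont in \<open>auto simp: split_beta\<close>)
  have cv: "integrable torus_measure (\<lambda>a. c s * (v a)\<^sup>2)"
    using L2_integrable_square[OF v] by simp
  have le: "(v a)\<^sup>2 * \<rho> s a \<le> c s * (v a)\<^sup>2" for a
    using mult_left_mono[OF \<rho>_le[OF s, of a], of "(v a)\<^sup>2"] by (simp add: mult.commute)
  have i: "integrable torus_measure (\<lambda>a. (v a)\<^sup>2 * \<rho> s a)"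
  proof (rule Bochner_Integration.integrable_bound[OF cv])
    show "(\<lambda>a. (v a)\<^sup>2 * \<rho> s a) \<in> borel_measurable torus_measure"
      by (intro measurable_torus) measurable
    show "AE a in torus_measure. norm ((v a)\<^sup>2 * \<rho> s a) \<le> norm (c s * (v a)\<^sup>2)"
      using le \<rho>_pos[OF s] c_pos[OF s] by (intro AE_I2) (simp add: abs_mult less_imp_le)
  qed
  show "(\<lambda>x. v (X s x)) \<in> L2_torus"
    unfolding L2_torus_iff using X_composition(1)[OF s i] by simp
  have "torus_integral (\<lambda>x. (v (X s x))\<^sup>2) = torus_integral (\<lambda>a. (v a)\<^sup>2 * \<rho> s a)"
    by (rule X_composition(2)[OF s i])
  also have "\<dots> \<le> torus_integral (\<lambda>a. c s * (v a)\<^sup>2)"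
    unfolding torus_integral_eq by (rule integral_mono[OF i cv]) (rule le)
  finally show "torus_integral (\<lambda>x. (v (X s x))\<^sup>2) \<le> c s * torus_integral (\<lambda>x. (v x)\<^sup>2)"
    by (simp add: torus_integral_eq)
qed

text \<open>The continuous part of \<open>Uxx\<close>.\<close>
definition R :: "real \<Rightarrow> real \<Rightarrow> real" where
  "R s x = K s * (s * (\<phi>' (X s x))\<^sup>2 / (1 - s * \<phi> (X s x)))"

lemma R_cont: "continuous_on (S \<times> UNIV) (\<lambda>p. R (fst p) (snd p))"
  unfolding R_def
  by (rule X_chain_cont[of "\<lambda>s a. K s * (s * (\<phi>' a)\<^sup>2 / (1 - s * \<phi> a))"])
     (auto simp: prod_neq_1 intro!: continuous_intros \<phi>_snd_cont \<phi>'_snd_cont fst_S_cont K_cont)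

lemma Uxx_eq: "Uxx s x = K s * w (X s x) + R s x"
  by (simp add: Uxx_def R_def distrib_left)

lemma Uxx_L2:
  assumes "s \<in> S" shows "Uxx s \<in> L2_torus"
proof -
  have "(\<lambda>x. K s * w (X s x) + R s x) \<in> L2_torus"
    by (intro L2_add L2_cmult X_comp_L2(1) assms w_L2 L2_continuous continuous_on_slice[OF R_cont])
  then show ?thesis by (simp add: Uxx_eq[abs_def])
qed

lemma U_weak_deriv: "s \<in> S \<Longrightarrow> has_weak_deriv (U s) (Ux s)"
  by (intro has_weak_deriv_C1 U_deriv_x Ux_cont_space periodic_ends U_periodic)

lemma \<gamma>_cont: "s \<in> S \<Longrightarrow> continuous_on UNIV (\<gamma> s)"
  using \<gamma>_deriv_a by (meson DERIV_isCont continuous_at_imp_continuous_on)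

text \<open>Pull the integral back to the Lagrangian variable, where the only factor that is not
  continuously differentiable is \<open>\<phi>'\<close>, and integrate by parts there against
  \<open>\<theta> = (\<psi> \<circ> \<gamma>) / (1 - s \<phi>)\<close>.\<close>
lemma Ux_weak_deriv:
  assumes s: "s \<in> S" shows "has_weak_deriv (Ux s) (Uxx s)"
  unfolding has_weak_deriv_def
proof (intro conjI ballI)
  show "Ux s \<in> L2_torus" by (rule L2_continuous[OF Ux_cont_space[OF s]])
  show "Uxx s \<in> L2_torus" by (rule Uxx_L2[OF s])
  fix \<psi> assume \<psi>: "\<psi> \<in> test_functions_torus"
  let ?d = "\<lambda>a. 1 - s * \<phi> a"
  define \<theta> where "\<theta> a = \<psi> (\<gamma> s a) / ?d a" for a
  define \<theta>' where "\<theta>' a = (deriv \<psi> (\<gamma> s a) * \<rho> s a * ?d a - \<psi> (\<gamma> s a) * (0 - s * \<phi>' a)) / (?d a * ?d a)" for a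
  define e where "e a = \<psi> (\<gamma> s a) * (s * (\<phi>' a)\<^sup>2 / (?d a)\<^sup>2)" for a
  have cont: "continuous_on UNIV (\<lambda>a. \<psi> (\<gamma> s a))" "continuous_on UNIV (\<lambda>a. deriv \<psi> (\<gamma> s a))"
    by (rule continuous_on_compose2[OF test_continuous[OF \<psi>, of UNIV] \<gamma>_cont[OF s]], simp)
       (rule continuous_on_compose2[OF test_deriv_continuous[OF \<psi>, of UNIV] \<gamma>_cont[OF s]], simp)
  have \<rho>c: "continuous_on UNIV (\<rho> s)"
    by (rule continuous_on_slice[of \<rho>, OF _ s]) (use \<rho>_cont in \<open>auto simp: split_beta\<close>)
  note dn = denom_neq[OF s]
  have \<theta>'c: "continuous_on UNIV \<theta>'"
    unfolding \<theta>'_def using dn by (intro continuous_intros cont \<rho>c \<phi>_cont \<phi>'_cont) auto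
  have \<theta>: "(\<theta> has_real_derivative \<theta>' a) (at a)" for a
  proof -
    have "((\<lambda>a. ?d a) has_real_derivative 0 - s * \<phi>' a) (at a)"
      by (intro DERIV_diff DERIV_const DERIV_cmult \<phi>_deriv)
    then show ?thesis
      unfolding \<theta>_def \<theta>'_def
      by (intro DERIV_divide DERIV_chain2[OF test_has_deriv[OF \<psi>] \<gamma>_deriv_a[OF s]] dn)
  qed
  have ends: "\<theta> pi = \<theta> (-pi)"
    using periodic_ends[OF test_periodic[OF \<psi>]] periodic_ends[OF \<phi>_periodic]
    by (simp add: \<theta>_def \<gamma>_left \<gamma>_right s)
  have ec: "continuous_on UNIV e"
    unfolding e_def using dn by (intro continuous_intros cont \<phi>_cont \<phi>'_cont) auto
  have \<theta>c: "continuous_on UNIV \<theta>"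
    unfolding \<theta>_def using dn by (intro continuous_intros cont \<phi>_cont) auto
  have \<theta>L: "\<theta> \<in> L2_torus" by (rule L2_continuous[OF \<theta>c])
  have id: "\<phi>' a / ?d a * deriv \<psi> (\<gamma> s a) * \<rho> s a = \<phi>' a * \<theta>' a - e a" for a
  proof -
    have "f / d * x * r = f * ((x * r * d - y * (0 - s * f)) / (d * d)) - y * (s * f\<^sup>2 / d\<^sup>2)"
      if "d \<noteq> 0" for d x y f r :: real
      using that by (simp add: field_simps power2_eq_square)
    from this[OF dn] show ?thesis by (simp only: \<theta>'_def e_def)
  qed
  have int: "integrable torus_measure (\<lambda>a. \<phi>' a * \<theta>' a)" "integrable torus_measure e"
    by (intro continuous_integrable continuous_intros \<phi>'_cont \<theta>'c ec)+
  have "torus_integral (\<lambda>x. Ux s x * deriv \<psi> x)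
      = torus_integral (\<lambda>x. (\<lambda>a. \<phi>' a / ?d a * deriv \<psi> (\<gamma> s a)) (X s x))"
    by (simp add: Ux_def \<gamma>_X s)
  also have "\<dots> = torus_integral (\<lambda>a. \<phi>' a * \<theta>' a - e a)"
    using X_composition(2)[OF s, of "\<lambda>a. \<phi>' a / ?d a * deriv \<psi> (\<gamma> s a)"] int unfolding id by simp
  also have "\<dots> = torus_integral (\<lambda>a. \<phi>' a * \<theta>' a) - torus_integral e"
    using int unfolding torus_integral_eq by simp
  also have "torus_integral (\<lambda>a. \<phi>' a * \<theta>' a) = - torus_integral (\<lambda>a. w a * \<theta> a)"
    by (rule primitive_integration_by_parts[OF w_L2 \<phi>'_primitive w_mean \<theta> \<theta>'c ends]) auto
  finally have lhs: "torus_integral (\<lambda>x. Ux s x * deriv \<psi> x) = - torus_integral (\<lambda>a. w a * \<theta> a) - torus_integral e" .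
  define h where "h a = K s * (w a + s * (\<phi>' a)\<^sup>2 / ?d a) * \<psi> (\<gamma> s a)" for a
  have hid: "h a * \<rho> s a = w a * \<theta> a + e a" for a
    using dn[of a] K_pos[OF s] by (simp add: h_def \<theta>_def e_def \<rho>_def A_def power2_eq_square add_divide_distrib distrib_left distrib_right)
  have wi: "integrable torus_measure (\<lambda>a. w a * \<theta> a)" by (rule L2_mult_integrable[OF w_L2 \<theta>L])
  have "torus_integral (\<lambda>x. Uxx s x * \<psi> x) = torus_integral (\<lambda>x. h (X s x))"
    by (simp add: Uxx_def h_def \<gamma>_X s)
  also have "\<dots> = torus_integral (\<lambda>a. w a * \<theta> a + e a)"
    using X_composition(2)[OF s, of h] wi int unfolding hid by simp
  also have "\<dots> = torus_integral (\<lambda>a. w a * \<theta> a) + torus_integral e"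
    using wi int unfolding torus_integral_eq by simp
  finally show "torus_integral (\<lambda>x. Ux s x * deriv \<psi> x) = - torus_integral (\<lambda>x. Uxx s x * \<psi> x)"
    using lhs by simp
qed

lemma U_H2: "s \<in> S \<Longrightarrow> U s \<in> H2_torus"
  unfolding H2_torus_def using U_cont_space U_periodic U_weak_deriv Ux_weak_deriv by blast

lemma L2_distance_tendsto_0:
  assumes h: "continuous_on (S \<times> UNIV) (\<lambda>p. h (fst p) (snd p))" and s0: "s0 \<in> S"
  shows "((\<lambda>s. torus_integral (\<lambda>x. (h s x - h s0 x)\<^sup>2)) \<longlongrightarrow> 0) (at s0)"
proof -
  have "continuous_on (S \<times> UNIV) (\<lambda>p. h s0 (snd p))"
    by (rule continuous_on_compose2[OF continuous_on_slice[OF h s0]]) (auto intro!: continuous_intros)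
  then have "continuous_on (S \<times> UNIV) (\<lambda>(s, x). (h s x - h s0 x)\<^sup>2)"
    unfolding split_beta by (intro continuous_intros h)
  then have "continuous_on S (\<lambda>s. torus_integral (\<lambda>x. (h s x - h s0 x)\<^sup>2))"
    by (rule param_torus_integral_continuous)
  then have "isCont (\<lambda>s. torus_integral (\<lambda>x. (h s x - h s0 x)\<^sup>2)) s0"
    using continuous_on_eq_continuous_at[OF open_S] s0 by blast
  then show ?thesis by (simp add: isCont_def torus_integral_eq)
qed

lemma S_eventually: "s0 \<in> S \<Longrightarrow> eventually (\<lambda>s. s \<in> S) (at s0)"
  using eventually_at_topological open_S by blast

text \<open>Approximate \<open>v\<close> in \<open>L\<^sup>2\<close> by a trigonometric polynomial \<open>p\<close>. The compositions of the remainder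
  \<open>z = v - p\<close> with \<open>X s\<close> are small uniformly for \<open>s\<close> near \<open>s0\<close>, because the Jacobians are bounded there.\<close>
lemma X_comp_L2_tendsto:
  assumes s0: "s0 \<in> S" and v: "v \<in> L2_torus"
  shows "((\<lambda>s. torus_integral (\<lambda>x. (v (X s x) - v (X s0 x))\<^sup>2)) \<longlongrightarrow> 0) (at s0)"
proof (rule tendstoI)
  fix e :: real assume "e > 0"
  define C where "C = c s0 + 1"
  have C: "C > 0" using c_pos[OF s0] by (simp add: C_def)
  \<comment> \<open>The two remainders contribute at most \<open>8 C d = 2 e / 3\<close> in total, and \<open>2 Q s\<close> less than \<open>e / 4\<close>.\<close>
  define d where "d = e / (12 * C)"
  have d: "d > 0" using \<open>e > 0\<close> C by (simp add: d_def)
  obtain p where p: "trig_poly p" "torus_integral (\<lambda>x. (v x - p x)\<^sup>2) < d"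
    using trig_poly_dense_L2[OF v d] .
  have pc: "continuous_on UNIV p" using p(1) by (rule trig_poly_continuous)
  have pL: "p \<in> L2_torus" by (rule L2_continuous[OF pc])
  define z where "z x = v x - p x" for x
  have zL: "z \<in> L2_torus" unfolding z_def by (rule L2_diff[OF v pL])
  have zd: "torus_integral (\<lambda>x. (z x)\<^sup>2) \<le> d" using p(2) by (simp add: z_def)
  define Q where "Q s = torus_integral (\<lambda>x. (p (X s x) - p (X s0 x))\<^sup>2)" for s
  have "(Q \<longlongrightarrow> 0) (at s0)"
    unfolding Q_def
    by (rule L2_distance_tendsto_0[of "\<lambda>s x. p (X s x)", OF _ s0])
       (rule continuous_on_compose2[OF pc X_cont], simp)
  then have ev1: "eventually (\<lambda>s. Q s < e / 8) (at s0)"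
    using \<open>e > 0\<close> by (intro order_tendstoD) auto
  have "(c \<longlongrightarrow> c s0) (at s0)"
    using c_cont s0 continuous_on_eq_continuous_at[OF open_S] by (auto simp: isCont_def)
  then have ev2: "eventually (\<lambda>s. c s < C) (at s0)"
    by (rule order_tendstoD) (simp add: C_def)
  show "eventually (\<lambda>s. dist (torus_integral (\<lambda>x. (v (X s x) - v (X s0 x))\<^sup>2)) 0 < e) (at s0)"
    using ev1 ev2 S_eventually[OF s0]
  proof eventually_elim
    case (elim s)
    have bound: "torus_integral (\<lambda>x. (z (X r x))\<^sup>2) \<le> C * d" if "r \<in> S" "c r \<le> C" for r
    proof -
      have "torus_integral (\<lambda>x. (z (X r x))\<^sup>2) \<le> c r * torus_integral (\<lambda>x. (z x)\<^sup>2)"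
        by (rule X_comp_L2(2)[OF that(1) zL])
      also have "\<dots> \<le> C * d"
        using that c_pos[OF that(1)] zd by (intro mult_mono torus_integral_nonneg) auto
      finally show ?thesis .
    qed
    have L: "(\<lambda>x. z (X s x)) \<in> L2_torus" "(\<lambda>x. z (X s0 x)) \<in> L2_torus"
      "(\<lambda>x. p (X s x)) \<in> L2_torus" "(\<lambda>x. p (X s0 x)) \<in> L2_torus"
      using elim s0 zL pL by (auto intro: X_comp_L2(1))
    have mL: "(\<lambda>x. - z (X s0 x)) \<in> L2_torus" using L2_cmult[OF L(2), of "-1"] by simp
    have "torus_integral (\<lambda>x. (v (X s x) - v (X s0 x))\<^sup>2)
        = torus_integral (\<lambda>x. ((z (X s x) + - z (X s0 x)) + (p (X s x) - p (X s0 x)))\<^sup>2)"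
      by (simp add: z_def)
    also have "\<dots> \<le> 2 * torus_integral (\<lambda>x. (z (X s x) + - z (X s0 x))\<^sup>2) + 2 * Q s"
      unfolding Q_def by (intro torus_integral_square_le L2_add L2_diff L mL)
    also have "torus_integral (\<lambda>x. (z (X s x) + - z (X s0 x))\<^sup>2)
        \<le> 2 * torus_integral (\<lambda>x. (z (X s x))\<^sup>2) + 2 * torus_integral (\<lambda>x. (- z (X s0 x))\<^sup>2)"
      by (intro torus_integral_square_le L mL)
    also have "\<dots> \<le> 4 * (C * d)"
      using bound[of s] bound[of s0] elim s0 by (simp add: C_def)
    finally have "torus_integral (\<lambda>x. (v (X s x) - v (X s0 x))\<^sup>2) \<le> 8 * (C * d) + 2 * Q s" by simp
    also have "C * d = e / 12" using C by (simp add: d_def)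
    finally show ?case
      using elim(1) \<open>e > 0\<close> torus_integral_nonneg[of "\<lambda>x. (v (X s x) - v (X s0 x))\<^sup>2"] by simp
  qed
qed

lemma Uxx_tendsto:
  assumes s0: "s0 \<in> S"
  shows "((\<lambda>s. torus_integral (\<lambda>x. (Uxx s x - Uxx s0 x)\<^sup>2)) \<longlongrightarrow> 0) (at s0)"
proof -
  define T where "T s = torus_integral (\<lambda>x. (w (X s x) - w (X s0 x))\<^sup>2)" for s
  define W where "W = torus_integral (\<lambda>x. (w (X s0 x))\<^sup>2)"
  define Q where "Q s = torus_integral (\<lambda>x. (R s x - R s0 x)\<^sup>2)" for s
  let ?b = "\<lambda>s. 4 * ((K s)\<^sup>2 * T s) + 4 * ((K s - K s0)\<^sup>2 * W) + 2 * Q s"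
  have K: "(K \<longlongrightarrow> K s0) (at s0)"
    using K_cont s0 continuous_on_eq_continuous_at[OF open_S] by (auto simp: isCont_def)
  have "(T \<longlongrightarrow> 0) (at s0)" unfolding T_def by (rule X_comp_L2_tendsto[OF s0 w_L2])
  moreover have "(Q \<longlongrightarrow> 0) (at s0)" unfolding Q_def by (rule L2_distance_tendsto_0[OF R_cont s0])
  ultimately have lim: "(?b \<longlongrightarrow> 4 * ((K s0)\<^sup>2 * 0) + 4 * ((K s0 - K s0)\<^sup>2 * W) + 2 * 0) (at s0)"
    by (intro tendsto_intros K)
  show ?thesis
  proof (rule tendsto_sandwich[OF _ _ tendsto_const])
    show "eventually (\<lambda>s. torus_integral (\<lambda>x. (Uxx s x - Uxx s0 x)\<^sup>2) \<le> ?b s) (at s0)"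
      using S_eventually[OF s0]
    proof eventually_elim
      case (elim s)
      have L: "(\<lambda>x. w (X s x)) \<in> L2_torus" "(\<lambda>x. w (X s0 x)) \<in> L2_torus"
        "R s \<in> L2_torus" "R s0 \<in> L2_torus"
        using elim s0 by (auto intro: X_comp_L2(1) w_L2 L2_continuous continuous_on_slice[OF R_cont])
      have "torus_integral (\<lambda>x. (Uxx s x - Uxx s0 x)\<^sup>2)
        = torus_integral (\<lambda>x. ((K s * (w (X s x) - w (X s0 x)) + (K s - K s0) * w (X s0 x)) + (R s x - R s0 x))\<^sup>2)"
        by (simp add: Uxx_eq algebra_simps)
      also have "\<dots> \<le> 2 * torus_integral (\<lambda>x. (K s * (w (X s x) - w (X s0 x)) + (K s - K s0) * w (X s0 x))\<^sup>2) + 2 * Q s"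
        unfolding Q_def by (intro torus_integral_square_le L2_add L2_diff L2_cmult L)
      also have "torus_integral (\<lambda>x. (K s * (w (X s x) - w (X s0 x)) + (K s - K s0) * w (X s0 x))\<^sup>2)
        \<le> 2 * torus_integral (\<lambda>x. (K s * (w (X s x) - w (X s0 x)))\<^sup>2) + 2 * torus_integral (\<lambda>x. ((K s - K s0) * w (X s0 x))\<^sup>2)"
        by (intro torus_integral_square_le L2_diff L2_cmult L)
      also have "torus_integral (\<lambda>x. (K s * (w (X s x) - w (X s0 x)))\<^sup>2) = (K s)\<^sup>2 * T s"
        by (simp add: T_def torus_integral_eq power_mult_distrib)
      also have "torus_integral (\<lambda>x. ((K s - K s0) * w (X s0 x))\<^sup>2) = (K s - K s0)\<^sup>2 * W"
        by (simp add: W_def torus_integral_eq power_mult_distrib)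
      finally show ?case by simp
    qed
    show "(?b \<longlongrightarrow> 0) (at s0)" using lim by simp
  qed (simp add: torus_integral_nonneg)
qed

lemma U_H2_continuous:
  assumes s0: "s0 \<in> S"
  shows "H2_norm_torus (\<lambda>x. U s0 x - U s0 x) = 0"
    and "isCont (\<lambda>s. H2_norm_torus (\<lambda>x. U s x - U s0 x)) s0"
proof -
  let ?n = "\<lambda>s. sqrt (torus_integral (\<lambda>x. (U s x - U s0 x)\<^sup>2) + torus_integral (\<lambda>x. (Ux s x - Ux s0 x)\<^sup>2)
     + torus_integral (\<lambda>x. (Uxx s x - Uxx s0 x)\<^sup>2))"
  have eq: "H2_norm_torus (\<lambda>x. U s x - U s0 x) = ?n s" if "s \<in> S" for s
    using that s0 by (intro H2_norm_torus_eq has_weak_deriv_diff U_weak_deriv Ux_weak_deriv)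
  show zero: "H2_norm_torus (\<lambda>x. U s0 x - U s0 x) = 0"
    unfolding eq[OF s0] by (simp add: torus_integral_eq)
  have "(?n \<longlongrightarrow> sqrt (0 + 0 + 0)) (at s0)"
    by (intro tendsto_intros L2_distance_tendsto_0 U_cont Ux_cont Uxx_tendsto s0)
  then have "((\<lambda>s. H2_norm_torus (\<lambda>x. U s x - U s0 x)) \<longlongrightarrow> sqrt (0 + 0 + 0)) (at s0)"
    by (rule Lim_transform_eventually) (use S_eventually[OF s0] in eventually_elim, simp add: eq)
  then show "isCont (\<lambda>s. H2_norm_torus (\<lambda>x. U s x - U s0 x)) s0" unfolding isCont_def zero by simp
qed

section \<open>Return to the original time\<close>
lemma lower_le_0_le_upper: "m \<le> 0" "0 \<le> M"
proof -
  have i: "integrable torus_measure \<phi>" by (rule continuous_integrable[OF \<phi>_cont])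
  have "torus_integral (\<lambda>x. m) \<le> torus_integral \<phi>" "torus_integral \<phi> \<le> torus_integral (\<lambda>x. M)"
    unfolding torus_integral_eq by (rule integral_mono; use i lower upper in simp)+
  then show "m \<le> 0" "0 \<le> M"
    using pi_gt_zero unfolding mean_zero torus_integral_const by (auto simp: mult_le_0_iff zero_le_mult_iff)
qed

text \<open>\<open>H\<close> is the original time as a function of the new time \<open>s\<close>, and \<open>\<eta>\<close> is its inverse.\<close>
definition H :: "real \<Rightarrow> real" where "H s = (LBINT r=ereal 0..ereal s. K r)"
definition \<eta> :: "real \<Rightarrow> real" where "\<eta> t = inv_into S H t"

lemma H_deriv: "s \<in> S \<Longrightarrow> (H has_real_derivative K s) (at s)"
  unfolding H_def using primitive_has_deriv_on[OF open_S convex_S zero_S _ K_cont] by (simp add: zero_ereal_def)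

lemma H_zero: "H 0 = 0" by (simp add: H_def)

lemma S_between: "a \<in> S \<Longrightarrow> b \<in> S \<Longrightarrow> a \<le> y \<Longrightarrow> y \<le> b \<Longrightarrow> y \<in> S"
  using closed_segment_subset[OF _ _ convex_S, of a b] by (auto simp: closed_segment_eq_real_ivl split: if_splits)

lemma H_inj: "inj_on H S"
proof -
  have "H a < H b" if "a \<in> S" "b \<in> S" "a < b" for a b
    by (rule DERIV_pos_imp_increasing[OF that(3)]) (use that H_deriv K_pos S_between in blast)
  then have "strict_mono_on S H" by (auto simp: strict_mono_on_def)
  then show ?thesis by (rule strict_mono_on_imp_inj_on)
qed

lemma H_ge: assumes "s \<in> S" "0 \<le> s" shows "s \<le> H s"
proof -
  have "H 0 - 0 \<le> H s - s"
  proof (rule DERIV_nonneg_imp_nondecreasing[OF assms(2)])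
    fix y assume "0 \<le> y" "y \<le> s"
    then have y: "y \<in> S" using S_between[OF zero_S assms(1)] by blast
    then show "\<exists>d. ((\<lambda>s. H s - s) has_real_derivative d) (at y) \<and> 0 \<le> d"
      using K_ge_1[OF y] by (intro exI[of _ "K y - 1"]) (auto intro!: derivative_eq_intros H_deriv)
  qed
  then show ?thesis by (simp add: H_zero)
qed

abbreviation I :: "real set" where "I \<equiv> time_interval (t_star M)"

text \<open>The times before \<open>t_star M\<close> are, read as values of \<open>s\<close>, the nonnegative elements of \<open>S\<close>.
  This covers \<open>M = 0\<close>, where \<open>t_star M = \<infinity>\<close>.\<close>
lemma time_S: assumes "t \<in> I" shows "0 \<le> t" "t \<in> S"
proof -
  show t: "0 \<le> t" using assms by (simp add: time_interval_def)
  have "t * M < 1"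
  proof (cases "M = 0")
    case False
    then have "M > 0" using lower_le_0_le_upper by simp
    then have "t < inverse M" using assms by (simp add: time_interval_def t_star_def)
    then show ?thesis using \<open>M > 0\<close> by (simp add: field_simps)
  qed simp
  moreover have "t * m \<le> 0" using t lower_le_0_le_upper by (intro mult_nonneg_nonpos)
  ultimately show "t \<in> S" by (simp add: S_def)
qed

text \<open>Since \<open>H 0 = 0\<close> and \<open>t \<le> H t\<close>, the value \<open>t\<close> is attained by \<open>H\<close> on \<open>[0, t]\<close>, which is
  contained in \<open>S\<close>.\<close>
lemma \<eta>_time: assumes "t \<in> I" shows "\<eta> t \<in> S" "H (\<eta> t) = t"
proof -
  note t = time_S[OF assms]
  have "continuous_on {0..t} H"
    using H_deriv S_between[OF zero_S t(2)]
    by (meson DERIV_isCont atLeastAtMost_iff continuous_at_imp_continuous_on)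
  then obtain s where "0 \<le> s" "s \<le> t" "H s = t"
    using IVT'[of H 0 t t] H_ge[OF t(2,1)] t(1) H_zero by auto
  then have "t \<in> H ` S" using S_between[OF zero_S t(2)] by blast
  then show "\<eta> t \<in> S" "H (\<eta> t) = t"
    unfolding \<eta>_def by (auto intro: inv_into_into f_inv_into_f)
qed

lemma \<eta>_zero: "\<eta> 0 = 0"
  unfolding \<eta>_def using inv_into_f_f[OF H_inj zero_S] by (simp add: H_zero)

lemma \<eta>_deriv:
  assumes "t \<in> I" shows "(\<eta> has_real_derivative A (\<eta> t)) (at t)"
proof -
  note t = \<eta>_time[OF assms]
  have "(\<eta> has_derivative (*) (A (\<eta> t))) (at (H (\<eta> t)))"
  proof (rule has_derivative_inverse_strong[OF open_S t(1)])
    show "continuous_on S H"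
      using H_deriv by (meson DERIV_isCont continuous_at_imp_continuous_on)
    show "\<eta> (H s) = s" if "s \<in> S" for s
      unfolding \<eta>_def by (rule inv_into_f_f[OF H_inj that])
    show "(H has_derivative (*) (K (\<eta> t))) (at (\<eta> t))"
      using H_deriv[OF t(1)] by (simp add: has_field_derivative_def)
    show "(*) (K (\<eta> t)) \<circ> (*) (A (\<eta> t)) = id"
      using K_pos[OF t(1)] by (simp add: fun_eq_iff A_def)
  qed
  then show ?thesis using t by (simp add: has_field_derivative_def)
qed

lemma B_time_deriv:
  assumes "t \<in> I"
  shows "((\<lambda>\<tau>. B (\<eta> \<tau>)) has_real_derivative A (\<eta> t) * B1 (\<eta> t)) (at t)"
  using DERIV_chain2[OF B_deriv[OF \<eta>_time(1)[OF assms]] \<eta>_deriv[OF assms]] by (simp add: mult.commute)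

lemma time_initial_segment: "t \<in> I \<Longrightarrow> 0 \<le> \<tau> \<Longrightarrow> \<tau> \<le> t \<Longrightarrow> \<tau> \<in> I"
  unfolding time_interval_def by (auto intro: le_less_trans[of "ereal \<tau>" "ereal t"])

lemma g_of_U:
  assumes "t \<in> I"
  shows "g_of (\<lambda>x \<tau>. U (\<eta> \<tau>) x) t = B (\<eta> t)"
proof -
  have t: "0 \<le> t" using assms by (simp add: time_interval_def)
  note seg = time_initial_segment[OF assms]
  have "(LBINT \<tau>=ereal 0..ereal t. (L2_norm_torus (\<lambda>x. U (\<eta> \<tau>) x))\<^sup>2)
      = (LBINT \<tau>=ereal 0..ereal t. pi * (A (\<eta> \<tau>) * B1 (\<eta> \<tau>)))"
  proof (rule interval_integral_cong)
    fix \<tau> assume "\<tau> \<in> einterval (min (ereal 0) (ereal t)) (max (ereal 0) (ereal t))"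
    then have "\<tau> \<in> I" using t by (intro seg) (auto simp: einterval_iff min_def max_def split: if_splits)
    then show "(L2_norm_torus (\<lambda>x. U (\<eta> \<tau>) x))\<^sup>2 = pi * (A (\<eta> \<tau>) * B1 (\<eta> \<tau>))"
      unfolding L2_norm_torus_sq by (intro energy \<eta>_time)
  qed
  also have "\<dots> = pi * B (\<eta> t) - pi * B (\<eta> 0)"
  proof (rule interval_integral_FTC_finite)
    have ivl: "{min 0 t..max 0 t} = {0..t}" using t by simp
    have "continuous_on {0..t} \<eta>"
      using \<eta>_deriv seg by (meson DERIV_isCont atLeastAtMost_iff continuous_at_imp_continuous_on)
    moreover have "\<eta> ` {0..t} \<subseteq> S" using \<eta>_time(1) seg by auto
    ultimately show "continuous_on {min 0 t..max 0 t} (\<lambda>\<tau>. pi * (A (\<eta> \<tau>) * B1 (\<eta> \<tau>)))"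
      unfolding ivl by (intro continuous_intros continuous_on_compose2[OF A_cont] continuous_on_compose2[OF B1_cont])
    fix \<tau> assume "min 0 t \<le> \<tau>" "\<tau> \<le> max 0 t"
    then have "\<tau> \<in> I" using t by (intro seg) auto
    then have "((\<lambda>\<tau>. pi * B (\<eta> \<tau>)) has_real_derivative pi * (A (\<eta> \<tau>) * B1 (\<eta> \<tau>))) (at \<tau>)"
      by (intro DERIV_cmult B_time_deriv)
    then show "((\<lambda>\<tau>. pi * B (\<eta> \<tau>)) has_vector_derivative pi * (A (\<eta> \<tau>) * B1 (\<eta> \<tau>))) (at \<tau> within {min 0 t..max 0 t})"
      by (simp add: has_real_derivative_iff_has_vector_derivative has_vector_derivative_at_within)
  qed
  finally show ?thesis by (simp add: g_of_def \<eta>_zero B_zero)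
qed

lemma U_zero: "U 0 x = \<phi> x"
proof -
  have J: "J 0 1 0 a = a + pi" for a
    using integral_of_deriv[of "\<lambda>x. 1" "\<lambda>x. x" "-pi" a] by (simp add: J_def)
  have A: "A 0 = 1" using J[of pi] by (simp add: A_def K_def)
  have "\<gamma> 0 x = x" by (simp add: \<gamma>_def A J del: One_nat_def)
  then have "X 0 x = x" using X_\<gamma>[OF zero_S, of x] by simp
  then show ?thesis by (simp add: U_def u_def A B_zero)
qed

lemma solution: "is_solution (t_star M) (\<lambda>x t. F (\<eta> t) x) (\<lambda>x t. U (\<eta> t) x)"
  unfolding is_solution_def
proof (intro ballI allI conjI)
  fix t x assume t: "t \<in> I"
  note s = \<eta>_time(1)[OF t]
  show "((\<lambda>y. F (\<eta> t) y) has_real_derivative U (\<eta> t) x) (at x)" by (rule F_deriv[OF s])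
  show "F (\<eta> t) x = (LBINT y=ereal (-pi)..ereal x. U (\<eta> t) y)" by (simp add: F_eq_integral[OF s])
  let ?g = "g_of (\<lambda>x \<tau>. U (\<eta> \<tau>) x)"
  show "\<exists>fxx gt. (U (\<eta> t) has_real_derivative fxx) (at x) \<and> (?g has_real_derivative gt) (at t within I) \<and>
     ((\<lambda>\<tau>. U (\<eta> \<tau>) x) has_real_derivative
        - gt - F (\<eta> t) x * fxx + (U (\<eta> t) x)\<^sup>2 + ?g t * U (\<eta> t) x) (at t within I)"
  proof (intro exI conjI)
    show "(U (\<eta> t) has_real_derivative Ux (\<eta> t) x) (at x)" by (rule U_deriv_x[OF s])
    show "(?g has_real_derivative A (\<eta> t) * B1 (\<eta> t)) (at t within I)"
      by (rule has_field_derivative_transform_within[OF has_field_derivative_at_within[OF B_time_deriv[OF t]] zero_less_one t])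
         (simp add: g_of_U)
    have "((\<lambda>\<tau>. U (\<eta> \<tau>) x) has_real_derivative
       K (\<eta> t) * (- (A (\<eta> t) * B1 (\<eta> t)) - F (\<eta> t) x * Ux (\<eta> t) x + (U (\<eta> t) x)\<^sup>2 + B (\<eta> t) * U (\<eta> t) x) * A (\<eta> t)) (at t)"
      by (rule DERIV_chain2[OF U_evolution[OF s] \<eta>_deriv[OF t]])
    moreover have "K (\<eta> t) * z * A (\<eta> t) = z" for z using K_pos[OF s] by (simp add: A_def)
    ultimately show "((\<lambda>\<tau>. U (\<eta> \<tau>) x) has_real_derivative
        - (A (\<eta> t) * B1 (\<eta> t)) - F (\<eta> t) x * Ux (\<eta> t) x + (U (\<eta> t) x)\<^sup>2 + ?g t * U (\<eta> t) x) (at t within I)"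
      unfolding g_of_U[OF t] by (simp only: has_field_derivative_at_within)
  qed
qed

lemma solution_C_H2: "(\<lambda>x t. U (\<eta> t) x) \<in> C_H2 (t_star M)"
  unfolding C_H2_def
proof (intro CollectI ballI conjI)
  fix t assume t: "t \<in> I"
  note s = \<eta>_time(1)[OF t]
  show "(\<lambda>x. U (\<eta> t) x) \<in> H2_torus" by (rule U_H2[OF s])
  have "(\<eta> \<longlongrightarrow> \<eta> t) (at t within I)"
    using DERIV_isCont[OF \<eta>_deriv[OF t]] by (meson continuous_at_imp_continuous_at_within continuous_within)
  from isCont_tendsto_compose[OF U_H2_continuous(2)[OF s] this]
  show "((\<lambda>\<tau>. H2_norm_torus (\<lambda>x. U (\<eta> \<tau>) x - U (\<eta> t) x)) \<longlongrightarrow> 0) (at t within I)"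
    unfolding U_H2_continuous(1)[OF s] .
qed

end

theorem theorem6p1:
  fixes \<phi>\<^sub>0 :: "real \<Rightarrow> real" and M\<^sub>0 :: real
  assumes "\<phi>\<^sub>0 \<in> H2_torus"
    and "torus_integral \<phi>\<^sub>0 = 0"
    and "M\<^sub>0 \<in> \<phi>\<^sub>0 ` {-pi..<pi}" and "\<forall>x\<in>{-pi..<pi}. \<phi>\<^sub>0 x \<le> M\<^sub>0"
  shows "\<exists>f fx. is_solution (t_star M\<^sub>0) f fx \<and> (\<forall>x. fx x 0 = \<phi>\<^sub>0 x) \<and> fx \<in> C_H2 (t_star M\<^sub>0)"
proof -
  have c: "continuous_on UNIV \<phi>\<^sub>0" and p: "periodic_2pi \<phi>\<^sub>0"
    using assms(1) by (auto simp: H2_torus_def)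
  have "compact (\<phi>\<^sub>0 ` {-pi..pi})"
    by (rule compact_continuous_image) (auto intro: continuous_on_subset[OF c])
  then obtain r where r: "\<And>x. x \<in> {-pi..pi} \<Longrightarrow> \<bar>\<phi>\<^sub>0 x\<bar> \<le> r"
    by (metis compact_imp_bounded bounded_real image_eqI)
  have lower: "- r \<le> \<phi>\<^sub>0 x" and upper: "\<phi>\<^sub>0 x \<le> M\<^sub>0" for x
  proof -
    obtain y where y: "y \<in> {-pi..<pi}" "\<phi>\<^sub>0 x = \<phi>\<^sub>0 y"
      using torus_representative[of x] p by metis
    then show "- r \<le> \<phi>\<^sub>0 x" "\<phi>\<^sub>0 x \<le> M\<^sub>0" using r[of y] assms(4) by auto
  qed
  obtain \<phi>' w where d: "\<And>x. (\<phi>\<^sub>0 has_real_derivative \<phi>' x) (at x)" "continuous_on UNIV \<phi>'" "periodic_2pi \<phi>'"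
    "w \<in> L2_torus" "torus_integral w = 0"
    "\<And>x. x \<in> {-pi..pi} \<Longrightarrow> \<phi>' x = \<phi>' (-pi) + (LBINT y=ereal (-pi)..ereal x. w y)"
    using H2_torus_classical[OF assms(1)] by metis
  interpret zero_mean_datum \<phi>\<^sub>0 \<phi>' w "- r" M\<^sub>0
    using d p assms(2) lower upper by unfold_locales
  show ?thesis
    using solution solution_C_H2 U_zero by (intro exI conjI allI) (auto simp: \<eta>_zero)
qed

end
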